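(* For every $\alpha>0$ there exist $\beta=\beta(\alpha)>0$ and a constant $C=C(\alpha)>0$ such that the following holds. Let $p$ be a prime, let $T$ be a positive integer, let $g\in\mathbb{F}_p^\times$ have multiplicative order at least $T$, and let $H=\{g^t: 0\le t<T\}$. If $|H|=T>p^{\alpha}$, then for every non-trivial additive character $\psi:\mathbb{F}_p\to\mathbb{C}$, $$\left|\sum_{x\in H}\psi(x)\right|\le C\,p^{-\beta}\,|H|.$$
   Context: A non-trivial additive character of $\mathbb{F}_p$ is a function of the form $\psi(x)=\exp\left(\frac{2\pi i x\xi}{p}\right)$ for some $\xi\in\mathbb{F}_p^\times$. In $H=\{g^t:0\le t<T\}$ the exponent $t$ runs over integers. *)

theory Defs
  imports "HOL-Analysis.Analysis" "HOL-Number_Theory.Residues"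
begin

(* The field F_p, carried by the integer representatives 0, ..., p - 1. *)
abbreviation prime_field :: "nat \<Rightarrow> int ring"
  where "prime_field p \<equiv> residue_ring (int p)"

(* The multiplicative order is taken in the group of units: the library notion
   of order refers to a group, which the multiplicative monoid of F_p is not. *)
abbreviation mult_order :: "nat \<Rightarrow> int \<Rightarrow> nat"
  where "mult_order p g \<equiv> group.ord (units_of (prime_field p)) g"

definition power_segment :: "nat \<Rightarrow> int \<Rightarrow> nat \<Rightarrow> int set"
  where "power_segment p g T = {g [^]\<^bsub>prime_field p\<^esub> t | t::nat. t < T}"

(* A character is constrained only on the carrier of F_p; its values at other
   integers are irrelevant. *)
definition nontrivial_additive_character :: "nat \<Rightarrow> (int \<Rightarrow> complex) \<Rightarrow> bool"
  where "nontrivial_additive_character p \<psi> \<longleftrightarrow>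
    (\<exists>\<xi>\<in>Units (prime_field p). \<forall>x\<in>carrier (prime_field p).
       \<psi> x = exp (2 * of_real pi * \<i> * of_int x * of_int \<xi> / of_nat p))"

end

(*
  Let T be the length of the segment H and suppose the sum over H of the character x |-> e(x xi0/p)
  exceeds 2 p^(-delta) T. Let L_i be the set of frequencies at which the sum over H is at least
  theta_i T, where theta_i = p^(-delta 3^i). Differences of elements of L_i fall into L_(i+1) for a
  proportion theta_i^2/2 of all pairs, and multiplication by g^s maps L_i into L_(i+1) as long as s
  is small compared with theta_i T, since shifting H changes the sum by at most 2 s. By pigeonhole
  some i has |L_(i+1)| <= p^eps |L_i|, so that L_i has large additive energy and is almost invariant
  under many dilations.

  The Balog-Szemeredi-Gowers theorem and Ruzsa's covering lemma turn L_i into a set S all of whose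
  iterated sumsets are small and such that u S is covered by few translates of S + S, for all u in a
  set U of size a power of p. The multipliers whose dilates of S are covered economically are
  closed under ring operations of bounded complexity. If the quotients (a - b)/(c - d) of a set miss
  a field element, then some y is a quotient while y + 1 is not, and (x, z) |-> x + (y + 1) z is
  injective on pairs; after clearing denominators the size of the set has been squared. Hence after
  boundedly many steps every field element y is a quotient of two good multipliers, and S + y S is
  small for all y. Averaging over y, this forces |S| to be close to 1 or to p, whereas Parseval and
  the near-invariance keep |L_i| away from both.
*)
theory Submission
  imports Defs "HOL-Library.Set_Algebras"
begin

section \<open>Balog--Szemeredi--Gowers\<close>

text \<open>\<open>H\<close> is a segment and not a subgroup, so no set of frequencies is exactly
  invariant under \<open>g\<close>; a chain of spectra replaces a single one. Cubing the threshold
  pays for both losses: for theta <= 1/2, theta^3 is at most theta^2/2 (differences) and at most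
  theta/2 (shifts), so no constants accumulate. The subset B given by Balog-Szemeredi-Gowers forgets
  the dilations: h B still lies in L_(i+1), which is not much larger than B, but need not resemble
  B. Coincidences are counted instead: many h B share a large part with one h0 B, and the ratios
  h/h0 form U. A quotient y = u/v of good multipliers need not be good itself, but S + y S has as
  many elements as v S + u S, which is enough. The number of ring operations must not depend on p: U
  has at least a fixed power of p elements, so the number of squarings, and with it every exponent,
  depends on alpha alone; eps is chosen afterwards. The factor 2 in the bound to be refuted makes
  theta_0 < 1/2 automatic, so small primes need no separate treatment.\<close>

definition reps :: "'a::ab_group_add set \<Rightarrow> 'a \<Rightarrow> nat"
  where "reps A d = card {x \<in> A. x - d \<in> A}"

lemma reps_le: "finite A \<Longrightarrow> reps A d \<le> card A"
  unfolding reps_def by (rule card_mono) auto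

lemma reps_minus: "reps A (- d) = reps A d"
proof -
  have "bij_betw (\<lambda>x. x + d) {x \<in> A. x - (- d) \<in> A} {x \<in> A. x - d \<in> A}"
    by (rule bij_betw_byWitness[where f' = "\<lambda>x. x - d"]) auto
  then show ?thesis
    unfolding reps_def by (rule bij_betw_same_card)
qed

lemma sum_reps:
  assumes "finite A" "finite D"
  shows "(\<Sum>d\<in>D. reps A d) = card {(x, y). x \<in> A \<and> y \<in> A \<and> x - y \<in> D}"
proof -
  have "(\<Sum>d\<in>D. reps A d) = card (SIGMA d:D. {x \<in> A. x - d \<in> A})"
    using assms by (simp add: reps_def)
  also have "bij_betw (\<lambda>(d, x). (x, x - d)) (SIGMA d:D. {x \<in> A. x - d \<in> A})
      {(x, y). x \<in> A \<and> y \<in> A \<and> x - y \<in> D}"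
    by (rule bij_betw_byWitness[where f' = "\<lambda>(x, y). (x - y, x)"]) auto
  then have "card (SIGMA d:D. {x \<in> A. x - d \<in> A}) = card {(x, y). x \<in> A \<and> y \<in> A \<and> x - y \<in> D}"
    by (rule bij_betw_same_card)
  finally show ?thesis .
qed

lemma sum_reps_le:
  assumes "finite A" "finite D"
  shows "(\<Sum>d\<in>D. reps A d) \<le> card A ^ 2"
proof -
  have "card {(x, y). x \<in> A \<and> y \<in> A \<and> x - y \<in> D} \<le> card (A \<times> A)"
    using assms by (intro card_mono) auto
  then show ?thesis
    using sum_reps[OF assms] by (simp add: power2_eq_square card_cartesian_product)
qed

text \<open>Averaging over the fibres A \<inter> (A + t). A pair \<open>x\<close>, \<open>y\<close>
  lies in the fibre of \<open>t\<close> only if (x - t) - (y - t) represents x - y, so a pair whose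
  difference has few representations lies in few fibres, while the energy makes the fibres large on
  average.\<close>

lemma exists_popular_fibre:
  fixes A D :: "'a::ab_group_add set" and K :: real
  assumes fin: "finite A" "finite D" and ne: "A \<noteq> {}" and K: "K > 0"
    and energy: "real (card A) ^ 3 \<le> K * (\<Sum>d\<in>D. real (reps A d) ^ 2)"
  obtains t where "real (card A) \<le> 2 * K * card {x \<in> A. x - t \<in> A}"
    and "8 * real (card {(x, y). x \<in> A \<and> x - t \<in> A \<and> y \<in> A \<and> y - t \<in> A \<and>
            16 * K * reps A (x - y) \<le> card A}) \<le> real (card {x \<in> A. x - t \<in> A}) ^ 2"
proof -
  define a where "a = real (card A)"
  have a: "a > 0"
    using fin ne by (simp add: a_def card_gt_0_iff)
  define P where "P = {(x, y). x \<in> A \<and> y \<in> A \<and> 16 * K * reps A (x - y) \<le> a}"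
  define bad where "bad t = {(x, y). x \<in> A \<and> x - t \<in> A \<and> y \<in> A \<and> y - t \<in> A \<and>
      16 * K * reps A (x - y) \<le> a}" for t
  have finbad: "finite (bad t)" for t
    by (rule finite_subset[of _ "A \<times> A"]) (auto simp: bad_def fin)
  have finP: "finite P"
    by (rule finite_subset[of _ "A \<times> A"]) (auto simp: P_def fin)
  have "card P \<le> card (A \<times> A)"
    by (rule card_mono) (use fin in \<open>auto simp: P_def\<close>)
  then have cardP: "card P \<le> card A ^ 2"
    by (simp only: power2_eq_square card_cartesian_product)
  have "(\<Sum>t\<in>D. card (bad t)) = card (SIGMA t:D. bad t)"
    using fin finbad by simp
  also have "bij_betw (\<lambda>(t, q). (q, t)) (SIGMA t:D. bad t)
      (SIGMA q:P. {t \<in> D. fst q - t \<in> A \<and> snd q - t \<in> A})"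
    by (rule bij_betw_byWitness[where f' = "\<lambda>(q, t). (t, q)"]) (auto simp: bad_def P_def)
  then have "card (SIGMA t:D. bad t) = card (SIGMA q:P. {t \<in> D. fst q - t \<in> A \<and> snd q - t \<in> A})"
    by (rule bij_betw_same_card)
  also have "\<dots> = (\<Sum>q\<in>P. card {t \<in> D. fst q - t \<in> A \<and> snd q - t \<in> A})"
    by (rule card_SigmaI) (use fin finP in auto)
  finally have "real (\<Sum>t\<in>D. card (bad t)) = (\<Sum>q\<in>P. real (card {t \<in> D. fst q - t \<in> A \<and> snd q - t \<in> A}))"
    by simp
  also have "\<dots> \<le> (\<Sum>q\<in>P. a / (16 * K))"
  proof (rule sum_mono)
    fix q assume q: "q \<in> P"
    have "card {t \<in> D. fst q - t \<in> A \<and> snd q - t \<in> A} \<le> reps A (fst q - snd q)"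
      unfolding reps_def
      by (rule card_inj_on_le[where f = "\<lambda>t. fst q - t"]) (use fin in \<open>auto simp: inj_on_def\<close>)
    also have "real (reps A (fst q - snd q)) \<le> a / (16 * K)"
      using q K by (auto simp: P_def field_simps)
    finally show "real (card {t \<in> D. fst q - t \<in> A \<and> snd q - t \<in> A}) \<le> a / (16 * K)"
      by simp
  qed
  also have "\<dots> \<le> a ^ 2 * (a / (16 * K))"
    using cardP a K by (auto simp: a_def simp flip: of_nat_power intro!: divide_right_mono mult_right_mono)
  finally have badsum: "(\<Sum>t\<in>D. real (card (bad t))) \<le> a ^ 3 / (16 * K)"
    by (simp add: power2_eq_square power3_eq_cube)
  \<comment> \<open>One inequality yields both claims. The sum of the squared fibre sizes minus 8
    times the number of bad pairs is at least a^3/(2K), while the fibre sizes add up to at most a^2.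
    Dropping empty fibres permits the later division by the size.\<close>
  have "\<exists>t\<in>D. reps A t > 0 \<and> a / (2 * K) * reps A t \<le> real (reps A t) ^ 2 - 8 * card (bad t)"
  proof (rule ccontr)
    assume neg: "\<not> ?thesis"
    define D' where "D' = {t \<in> D. reps A t > 0}"
    have finD': "finite D'" using fin by (auto simp: D'_def)
    have sub: "(\<Sum>t\<in>D. real (reps A t) ^ 2) = (\<Sum>t\<in>D'. real (reps A t) ^ 2)"
      by (rule sum.mono_neutral_right) (use fin in \<open>auto simp: D'_def\<close>)
    have "0 < K * (\<Sum>d\<in>D. real (reps A d) ^ 2)"
      using energy a by (metis a_def less_le_trans zero_less_power)
    then have "D' \<noteq> {}"
      using sub by auto
    then have "(\<Sum>t\<in>D'. real (reps A t) ^ 2 - 8 * card (bad t)) < (\<Sum>t\<in>D'. a / (2 * K) * reps A t)"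
      using neg by (intro sum_strict_mono finD') (auto simp: D'_def not_le)
    also have "\<dots> = a / (2 * K) * (\<Sum>t\<in>D'. reps A t)"
      by (simp add: sum_distrib_left)
    also have "\<dots> \<le> a / (2 * K) * a ^ 2"
    proof -
      have "real (\<Sum>t\<in>D'. reps A t) \<le> a ^ 2"
        using sum_reps_le[OF fin(1) finD'] unfolding a_def of_nat_power[symmetric] of_nat_le_iff .
      then show ?thesis
        using a K by (intro mult_left_mono) auto
    qed
    finally have 1: "(\<Sum>t\<in>D'. real (reps A t) ^ 2) - 8 * (\<Sum>t\<in>D'. real (card (bad t))) < a ^ 3 / (2 * K)"
      by (simp add: sum_subtractf sum_distrib_left power2_eq_square power3_eq_cube)
    have "(\<Sum>t\<in>D'. real (card (bad t))) \<le> (\<Sum>t\<in>D. real (card (bad t)))"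
      by (rule sum_mono2) (use fin in \<open>auto simp: D'_def\<close>)
    then have "(\<Sum>t\<in>D'. real (card (bad t))) \<le> a ^ 3 / (16 * K)"
      using badsum by simp
    moreover have "a ^ 3 / K \<le> (\<Sum>t\<in>D'. real (reps A t) ^ 2)"
      using energy K sub by (simp add: a_def field_simps)
    ultimately show False
      using 1 by (simp add: field_simps)
  qed
  then obtain t where t: "reps A t > 0" "a / (2 * K) * reps A t \<le> real (reps A t) ^ 2 - 8 * card (bad t)"
    by blast
  have "a / (2 * K) * reps A t \<le> real (reps A t) * reps A t"
    using t(2) by (simp add: power2_eq_square)
  then have "a / (2 * K) \<le> reps A t"
    by (rule mult_right_le_imp_le) (use t(1) in simp)
  then have "a \<le> 2 * K * reps A t"
    using K by (simp add: field_simps)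
  moreover have "0 \<le> a / (2 * K) * reps A t"
    using a K by simp
  then have "8 * real (card (bad t)) \<le> real (reps A t) ^ 2"
    using t(2) by linarith
  ultimately show thesis
    using that[of t] by (simp add: reps_def a_def bad_def)
qed

text \<open>Two elements that have popular differences with more than three quarters of a set share many
  neighbours there, which makes their own difference popular.\<close>

lemma Balog_Szemeredi_Gowers:
  fixes A D :: "'a::ab_group_add set" and K :: real
  assumes fin: "finite A" "finite D" and ne: "A \<noteq> {}" and K: "K > 0"
    and energy: "real (card A) ^ 3 \<le> K * (\<Sum>d\<in>D. real (reps A d) ^ 2)"
  obtains B where "B \<subseteq> A" "real (card A) \<le> 4 * K * card B"
    and "real (card (B + uminus ` B)) \<le> 4096 * K ^ 4 * card B"
proof -
  obtain t where t1: "real (card A) \<le> 2 * K * card {x \<in> A. x - t \<in> A}"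
    and t2: "8 * real (card {(x, y). x \<in> A \<and> x - t \<in> A \<and> y \<in> A \<and> y - t \<in> A \<and>
            16 * K * reps A (x - y) \<le> card A}) \<le> real (card {x \<in> A. x - t \<in> A}) ^ 2"
    using exists_popular_fibre[OF assms] .
  define a where "a = real (card A)"
  have a: "a > 0"
    using fin ne by (simp add: a_def card_gt_0_iff)
  define A' where "A' = {x \<in> A. x - t \<in> A}"
  have A': "A' \<subseteq> A" "finite A'" using fin by (auto simp: A'_def)
  define a' where "a' = real (card A')"
  have aa': "a \<le> 2 * K * a'"
    using t1 by (simp add: a_def a'_def A'_def)
  then have a': "a' > 0"
    using a K by (metis less_le_trans zero_less_mult_pos zero_less_mult_iff zero_less_numeral)
  define bad where "bad x = {y \<in> A'. 16 * K * reps A (x - y) \<le> a}" for x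
  have finbad: "finite (bad x)" for x using A' by (auto simp: bad_def)
  \<comment> \<open>There are at most a'^2/8 bad pairs, so by Markov's inequality at least half of
    \<open>A'\<close> survives.\<close>
  define B where "B = {x \<in> A'. 4 * real (card (bad x)) \<le> a'}"
  have "real (card (SIGMA x:A'. bad x)) = (\<Sum>x\<in>A'. real (card (bad x)))"
    using A' finbad by simp
  moreover have "(SIGMA x:A'. bad x) = {(x, y). x \<in> A \<and> x - t \<in> A \<and> y \<in> A \<and> y - t \<in> A \<and>
            16 * K * reps A (x - y) \<le> card A}"
    by (auto simp: A'_def bad_def a_def)
  ultimately have bs: "8 * (\<Sum>x\<in>A'. real (card (bad x))) \<le> a' ^ 2"
    using t2 by (simp add: a'_def A'_def)
  have "2 * (\<Sum>x\<in>A' - B. a') \<le> 8 * (\<Sum>x\<in>A' - B. real (card (bad x)))"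
    unfolding sum_distrib_left by (rule sum_mono) (auto simp: B_def)
  also have "\<dots> \<le> 8 * (\<Sum>x\<in>A'. real (card (bad x)))"
    using A' by (intro mult_left_mono sum_mono2) auto
  also have "\<dots> \<le> a' * a'" using bs by (simp add: power2_eq_square)
  finally have "2 * real (card (A' - B)) \<le> a'"
    using a' by simp
  moreover have "card (A' - B) = card A' - card B" "card B \<le> card A'"
    using A' by (auto simp: B_def intro!: card_Diff_subset card_mono)
  ultimately have cB: "a' \<le> 2 * real (card B)"
    by (simp add: a'_def of_nat_diff)
  have finB: "finite B" using A' by (auto simp: B_def)
  \<comment> \<open>For d = x - x' with \<open>x\<close>, \<open>x'\<close> in \<open>B\<close>,
    each common neighbour \<open>y\<close> gives d = (x - y) - (x' - y), and either bracket has at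
    least a/(16K) representations. The sets \<open>W d\<close> are disjoint in A^4, which bounds the
    number of \<open>d\<close>.\<close>
  define W where "W d = {q \<in> (A \<times> A) \<times> (A \<times> A).
      d = (fst (fst q) - snd (fst q)) - (fst (snd q) - snd (snd q))}" for d
  have finW: "finite (W d)" for d using fin by (auto simp: W_def)
  have W: "a' / 2 * (a / (16 * K)) ^ 2 \<le> card (W d)" if "d \<in> B + uminus ` B" for d
  proof -
    obtain x x' where x: "x \<in> B" "x' \<in> B" "d = x - x'"
      using \<open>d \<in> B + uminus ` B\<close> by (auto elim!: set_plus_elim)
    define Y where "Y = A' - (bad x \<union> bad x')"
    define R where "R z = {u \<in> A. u - z \<in> A}" for z :: 'a
    have finR: "finite (R z)" for z using fin by (auto simp: R_def)
    have "card (bad x \<union> bad x') \<le> card (bad x) + card (bad x')"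
      by (rule card_Un_le)
    moreover have "4 * real (card (bad x)) \<le> a'" "4 * real (card (bad x')) \<le> a'"
      using x by (auto simp: B_def)
    moreover have "card Y = card A' - card (bad x \<union> bad x')"
      unfolding Y_def by (rule card_Diff_subset) (auto simp: bad_def A')
    ultimately have Y: "a' / 2 \<le> real (card Y)"
      unfolding a'_def by linarith
    have "a' / 2 * (a / (16 * K)) ^ 2 \<le> real (card Y) * (a / (16 * K)) ^ 2"
      using Y by (intro mult_right_mono) auto
    also have "\<dots> = (\<Sum>y\<in>Y. (a / (16 * K)) * (a / (16 * K)))"
      by (simp add: power2_eq_square)
    also have "\<dots> \<le> (\<Sum>y\<in>Y. real (card (R (x - y))) * real (card (R (x' - y))))"
    proof (intro sum_mono mult_mono)
      fix y assume "y \<in> Y"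
      then show "a / (16 * K) \<le> real (card (R (x - y)))" "a / (16 * K) \<le> real (card (R (x' - y)))"
        using K by (auto simp: Y_def bad_def reps_def R_def field_simps not_le)
    qed (use a K in auto)
    also have "\<dots> = real (card (SIGMA y:Y. R (x - y) \<times> R (x' - y)))"
      using A' finR by (subst card_SigmaI) (auto simp: card_cartesian_product Y_def)
    also have "card (SIGMA y:Y. R (x - y) \<times> R (x' - y)) \<le> card (W d)"
    proof (rule card_inj_on_le[where f = "\<lambda>(y, u, v). ((u, u - (x - y)), (v, v - (x' - y)))"])
      show "inj_on (\<lambda>(y, u, v). ((u, u - (x - y)), (v, v - (x' - y)))) (SIGMA y:Y. R (x - y) \<times> R (x' - y))"
        by (auto simp: inj_on_def)
      show "(\<lambda>(y, u, v). ((u, u - (x - y)), (v, v - (x' - y)))) ` (SIGMA y:Y. R (x - y) \<times> R (x' - y)) \<subseteq> W d"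
        by (auto simp: W_def R_def x(3))
    qed (rule finW)
    finally show ?thesis by simp
  qed
  have finS: "finite (B + uminus ` B)"
    using finB by (intro finite_set_plus) auto
  have "real (card (B + uminus ` B)) * (a' / 2 * (a / (16 * K)) ^ 2) = (\<Sum>d\<in>B + uminus ` B. a' / 2 * (a / (16 * K)) ^ 2)"
    by simp
  also have "\<dots> \<le> (\<Sum>d\<in>B + uminus ` B. real (card (W d)))"
    by (rule sum_mono) (rule W)
  also have "\<dots> = real (card (\<Union>d\<in>B + uminus ` B. W d))"
    by (subst card_UN_disjoint) (use finS finW in \<open>auto simp: W_def\<close>)
  also have "card (\<Union>d\<in>B + uminus ` B. W d) \<le> card ((A \<times> A) \<times> (A \<times> A))"
    using fin by (intro card_mono) (auto simp: W_def)
  also have "real (card ((A \<times> A) \<times> (A \<times> A))) = a ^ 4"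
    by (simp add: card_cartesian_product a_def power4_eq_xxxx)
  finally have "real (card (B + uminus ` B)) * a' * a ^ 2 \<le> (512 * K ^ 2 * a ^ 2) * a ^ 2"
    using K by (simp add: field_simps power4_eq_xxxx power2_eq_square)
  then have "real (card (B + uminus ` B)) * a' \<le> 512 * K ^ 2 * a ^ 2"
    using a by (simp add: mult_le_cancel_right)
  also have "\<dots> \<le> 512 * K ^ 2 * (2 * K * a') ^ 2"
    using aa' a by (intro mult_left_mono power_mono) auto
  also have "\<dots> = (2048 * K ^ 4 * a') * a'"
    by (simp add: power2_eq_square power4_eq_xxxx)
  finally have "real (card (B + uminus ` B)) \<le> 2048 * K ^ 4 * a'"
    using a' by (simp add: mult_le_cancel_right)
  also have "\<dots> \<le> 2048 * K ^ 4 * (2 * real (card B))"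
    using cB K by (intro mult_left_mono) auto
  finally have "real (card (B + uminus ` B)) \<le> 4096 * K ^ 4 * card B"
    by simp
  moreover have "a \<le> 4 * K * card B"
    using order_trans[OF aa' mult_left_mono[OF cB, of "2 * K"]] K by simp
  moreover have "B \<subseteq> A" using A' by (auto simp: B_def)
  ultimately show thesis using that by (simp add: a_def)
qed

section \<open>Iterated sumsets and coverings\<close>

primrec nsums :: "nat \<Rightarrow> 'a::comm_monoid_add set \<Rightarrow> 'a set"
  where "nsums 0 S = {0}" | "nsums (Suc n) S = S + nsums n S"

text \<open>Counts the ordered representations of \<open>z\<close> by n + 1 summands from
  \<open>D\<close>, not by n: telescoping turns n differences and two end points into n + 1
  differences.\<close>

primrec sum_reps_count :: "'a::ab_group_add set \<Rightarrow> nat \<Rightarrow> 'a \<Rightarrow> nat"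
  where "sum_reps_count D 0 z = (if z \<in> D then 1 else 0)"
  | "sum_reps_count D (Suc n) z = (\<Sum>q\<in>D. sum_reps_count D n (z - q))"

lemma finite_nsums: "finite S \<Longrightarrow> finite (nsums n S)"
  by (induction n) (auto intro: finite_set_plus)

lemma nsums_add: "nsums (m + n) S = nsums m S + nsums n S"
  by (induction m) (auto simp: add.assoc)

lemma nsums_mono:
  assumes "0 \<in> S" "m \<le> n"
  shows "nsums m S \<subseteq> nsums n S"
proof -
  have "0 \<in> nsums k S" for k
    using assms(1) set_plus_intro[of 0 S 0] by (induction k) auto
  then have "nsums m S \<subseteq> nsums m S + nsums (n - m) S"
    by (metis add.commute set_zero_plus2)
  then show ?thesis
    using assms(2) by (simp flip: nsums_add)
qed

lemma diff_in_set_plus: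
  "x \<in> A \<Longrightarrow> y \<in> B \<Longrightarrow> x - y \<in> A + uminus ` (B :: 'a::ab_group_add set)"
  by (metis diff_conv_add_uminus imageI set_plus_intro)

lemma in_set_plus_uminusE:
  assumes "z \<in> A + uminus ` (B :: 'a::ab_group_add set)"
  obtains x y where "x \<in> A" "y \<in> B" "z = x - y"
  using assms by (auto elim!: set_plus_elim)

lemma sum_sum_reps_count:
  assumes "finite D" "finite Z"
  shows "(\<Sum>z\<in>Z. sum_reps_count D n z) \<le> card D ^ Suc n"
  using assms(2)
proof (induction n arbitrary: Z)
  case 0
  have "(\<Sum>z\<in>Z. sum_reps_count D 0 z) = card (Z \<inter> D)"
    using 0 by (simp add: sum.If_cases)
  then show ?case using assms by (simp add: card_mono)
next
  case (Suc n)
  have "(\<Sum>z\<in>Z. sum_reps_count D (Suc n) z) = (\<Sum>q\<in>D. \<Sum>z\<in>Z. sum_reps_count D n (z - q))"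
    by (simp add: sum.swap[of _ D])
  also have "\<dots> = (\<Sum>q\<in>D. \<Sum>z\<in>(\<lambda>z. z - q) ` Z. sum_reps_count D n z)"
    by (simp add: sum.reindex inj_on_def)
  also have "\<dots> \<le> (\<Sum>q\<in>D. card D ^ Suc n)"
    by (rule sum_mono, rule Suc.IH) (use Suc.prems in auto)
  finally show ?case by simp
qed

text \<open>The sum \<open>b + (x\<^sub>1 - y\<^sub>1) + \<dots> + (x\<^sub>n - y\<^sub>n) - c\<close> telescopes as
  \<open>(b - y\<^sub>1) + (x\<^sub>1 - y\<^sub>2) + \<dots> + (x\<^sub>n - c)\<close>.\<close>

lemma sum_reps_count_ge:
  fixes B S :: "'a::ab_group_add set" and m :: real
  assumes fin: "finite B" and m: "m \<ge> 0" "\<And>s. s \<in> S \<Longrightarrow> m \<le> reps B s"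
    and "b \<in> B" "c \<in> B" "z \<in> nsums n S"
  shows "m ^ n \<le> sum_reps_count (B + uminus ` B) n (b + z - c)"
  using \<open>b \<in> B\<close> \<open>z \<in> nsums n S\<close>
proof (induction n arbitrary: b z)
  case 0
  then have "b - c \<in> B + uminus ` B"
    using \<open>c \<in> B\<close> by (metis diff_conv_add_uminus imageI set_plus_intro)
  with 0 show ?case by simp
next
  case (Suc n)
  let ?D = "B + uminus ` B"
  obtain s w where sw: "s \<in> S" "w \<in> nsums n S" "z = s + w"
    using Suc.prems by (auto elim: set_plus_elim)
  define X where "X = {x \<in> B. x - s \<in> B}"
  \<comment> \<open>Here \<open>x - s\<close> acts as the first subtracted element and
    \<open>x\<close> replaces \<open>b\<close> in the induction; distinct \<open>x\<close> give
    distinct first summands.\<close>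
  define f where "f x = b - (x - s)" for x
  have injf: "inj_on f X"
    by (auto simp: inj_on_def f_def)
  have fX: "f ` X \<subseteq> ?D"
  proof
    fix q assume "q \<in> f ` X"
    then obtain x where "q = b + - (x - s)" "x - s \<in> B" by (auto simp: f_def X_def)
    then show "q \<in> ?D" using Suc.prems by blast
  qed
  have finD: "finite ?D" using fin by (intro finite_set_plus) auto
  have "m ^ Suc n \<le> real (card X) * m ^ n"
    using m(1) m(2)[OF sw(1)] by (simp add: X_def reps_def mult_right_mono)
  also have "\<dots> = (\<Sum>x\<in>X. m ^ n)" by simp
  also have "\<dots> \<le> (\<Sum>x\<in>X. real (sum_reps_count ?D n (x + w - c)))"
    by (rule sum_mono, rule Suc.IH) (use sw in \<open>auto simp: X_def\<close>)
  also have "\<dots> = (\<Sum>x\<in>X. real (sum_reps_count ?D n (b + z - c - f x)))"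
    by (intro sum.cong refl arg_cong[of _ _ "\<lambda>u. real (sum_reps_count ?D n u)"])
      (simp add: f_def sw(3) algebra_simps)
  also have "\<dots> = (\<Sum>q\<in>f ` X. real (sum_reps_count ?D n (b + z - c - q)))"
    by (simp add: sum.reindex[OF injf])
  also have "\<dots> \<le> (\<Sum>q\<in>?D. real (sum_reps_count ?D n (b + z - c - q)))"
    by (rule sum_mono2[OF finD fX]) simp
  finally show ?case by simp
qed

text \<open>Counting representations plays the role of a Pluennecke inequality: every element of (B
  - B) + n S is a sum of n + 1 elements of B - B in at least (b/(2K))^n ways, and there are at most
  (K b)^(n+1) such sums. The lower bound rests on popularity, hence \<open>S\<close> instead of B -
  B.\<close>

lemma popular_differences:
  fixes B :: "'a::ab_group_add set" and K :: real
  assumes fin: "finite B" and ne: "B \<noteq> {}" and K: "real (card (B + uminus ` B)) \<le> K * card B"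
  obtains S where "S \<subseteq> B + uminus ` B" "0 \<in> S" "uminus ` S = S" "card B \<le> 2 * card S"
    and "\<And>n. real (card ((B + uminus ` B) + nsums n S)) \<le> (2 * K) ^ n * K ^ Suc n * card B"
proof -
  let ?D = "B + uminus ` B"
  define b where "b = real (card B)"
  have b: "b > 0" using fin ne by (simp add: b_def card_gt_0_iff)
  have finD: "finite ?D" using fin by (intro finite_set_plus) auto
  obtain b0 where b0: "b0 \<in> B" using ne by auto
  have "card B \<le> card ?D"
    by (rule card_inj_on_le[where f = "\<lambda>x. x + - b0"]) (use b0 finD in \<open>auto simp: inj_on_def simp del: add_uminus_conv_diff\<close>)
  then have "b \<le> K * b" using K by (simp add: b_def)
  then have K1: "K \<ge> 1" using b by simp
  \<comment> \<open>Half the average popularity: the |B|^2 pairs share at most K|B| differences, so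
    those left out account for at most half of the pairs.\<close>
  define S where "S = {d \<in> ?D. b \<le> 2 * K * reps B d}"
  have SD: "S \<subseteq> ?D" by (auto simp: S_def)
  have finS: "finite S" using finite_subset[OF SD finD] .
  have "b0 + - b0 \<in> ?D" using b0 by blast
  moreover have "b \<le> 2 * K * b" using K1 b by simp
  ultimately have 0: "0 \<in> S" by (simp add: S_def reps_def b_def)
  have "- d \<in> ?D" if "d \<in> ?D" for d
  proof -
    from that obtain x y where "x \<in> B" "y \<in> B" "d = x - y" by (rule in_set_plus_uminusE)
    then show ?thesis using diff_in_set_plus[of y B x B] by simp
  qed
  then have "- d \<in> S" if "d \<in> S" for d
    using that by (simp add: S_def reps_minus)
  then have sym: "uminus ` S = S"
    by (metis (no_types, lifting) add.inverse_inverse image_eqI image_subsetI subsetI subset_antisym)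
  have "b ^ 2 = (\<Sum>d\<in>?D. real (reps B d))"
  proof -
    have "{(x, y). x \<in> B \<and> y \<in> B \<and> x - y \<in> ?D} = B \<times> B"
      by (auto simp: diff_conv_add_uminus simp del: add_uminus_conv_diff)
    then have "(\<Sum>d\<in>?D. reps B d) = card B * card B"
      using sum_reps[OF fin finD] by (simp add: card_cartesian_product)
    then show ?thesis by (simp add: b_def power2_eq_square flip: of_nat_sum of_nat_mult)
  qed
  also have "\<dots> = (\<Sum>d\<in>S. real (reps B d)) + (\<Sum>d\<in>?D - S. real (reps B d))"
    using sum.subset_diff[OF SD finD, of "\<lambda>d. real (reps B d)"] by simp
  also have "\<dots> \<le> (\<Sum>d\<in>S. b) + (\<Sum>d\<in>?D - S. b / (2 * K))"
  proof (intro add_mono sum_mono)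
    show "real (reps B d) \<le> b" for d
      using reps_le[OF fin, of d] by (simp add: b_def)
    show "real (reps B d) \<le> b / (2 * K)" if "d \<in> ?D - S" for d
      using that K1 by (auto simp: S_def field_simps)
  qed
  also have "\<dots> \<le> card S * b + (K * b) * (b / (2 * K))"
  proof -
    have "real (card (?D - S)) \<le> real (card ?D)"
      using finD by (intro of_nat_mono card_mono) auto
    then have "real (card (?D - S)) \<le> K * b" using K by (simp add: b_def)
    then have "real (card (?D - S)) * (b / (2 * K)) \<le> (K * b) * (b / (2 * K))"
      using b K1 by (intro mult_right_mono) auto
    then show ?thesis by simp
  qed
  also have "\<dots> = card S * b + b ^ 2 / 2"
    using K1 by (simp add: power2_eq_square)
  finally have "b * b \<le> (2 * real (card S)) * b"
    by (simp add: power2_eq_square)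
  then have "b \<le> 2 * real (card S)"
    by (rule mult_right_le_imp_le) (rule b)
  then have cS: "card B \<le> 2 * card S"
    by (simp add: b_def)
  have "real (card (?D + nsums n S)) \<le> (2 * K) ^ n * K ^ Suc n * card B" for n
  proof -
    let ?Z = "?D + nsums n S"
    have finZ: "finite ?Z" by (rule finite_set_plus[OF finD finite_nsums[OF finS]])
    define m where "m = b / (2 * K)"
    have m: "m > 0" using b K1 by (simp add: m_def)
    have ms: "m \<le> reps B s" if "s \<in> S" for s
      using that K1 by (auto simp: S_def m_def field_simps)
    have "card ?Z * m ^ n = (\<Sum>z\<in>?Z. m ^ n)" by simp
    also have "\<dots> \<le> (\<Sum>z\<in>?Z. real (sum_reps_count ?D n z))"
    proof (rule sum_mono)
      fix z assume "z \<in> ?Z"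
      then obtain x y w where xyw: "x \<in> B" "y \<in> B" "w \<in> nsums n S" "z = x + - y + w"
        by (auto elim!: set_plus_elim)
      then have "z = x + w - y" by (simp add: algebra_simps)
      then show "m ^ n \<le> real (sum_reps_count ?D n z)"
        using sum_reps_count_ge[OF fin _ ms xyw(1-3)] m by simp
    qed
    also have "\<dots> \<le> real (card ?D ^ Suc n)"
      using sum_sum_reps_count[OF finD finZ, of n] by (simp flip: of_nat_sum of_nat_power of_nat_mult)
    also have "\<dots> \<le> (K * b) ^ Suc n"
      unfolding of_nat_power using K by (intro power_mono) (auto simp: b_def)
    also have "\<dots> = ((2 * K) ^ n * K ^ Suc n * b) * m ^ n"
      using K1 b by (simp add: m_def power_mult_distrib power_divide field_simps)
    finally show ?thesis
      using m by (simp add: mult_le_cancel_right b_def)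
  qed
  then show thesis using that SD 0 sym cS by blast
qed

section \<open>Coverings by few translates, and good multipliers\<close>

text \<open>Take a maximal family of disjoint translates A + x with x in \<open>B\<close>. All lie
  in A + B, and by maximality any further A + y meets one of them, which puts y - x into A -
  A.\<close>

lemma Ruzsa_covering:
  fixes A B :: "'a::ab_group_add set"
  assumes fin: "finite A" "finite B" and ne: "A \<noteq> {}"
  obtains X where "X \<subseteq> B" "card X * card A \<le> card (A + B)" "B \<subseteq> X + (A + uminus ` A)"
proof -
  define P where "P X \<longleftrightarrow> X \<subseteq> B \<and> inj_on (\<lambda>(a, x). a + x) (A \<times> X)" for X
  have "finite {X. P X}"
    by (rule finite_subset[of _ "Pow B"]) (auto simp: P_def fin)
  moreover have "P {}" by (simp add: P_def)
  ultimately obtain X where X: "P X" and max: "\<And>Y. P Y \<Longrightarrow> X \<subseteq> Y \<Longrightarrow> X = Y"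
    using finite_has_maximal[of "{X. P X}"] by blast
  have XB: "X \<subseteq> B" and inj: "inj_on (\<lambda>(a, x). a + x) (A \<times> X)" using X by (auto simp: P_def)
  have "card X * card A = card ((\<lambda>(a, x). a + x) ` (A \<times> X))"
    by (simp add: card_image[OF inj] card_cartesian_product)
  also have "\<dots> \<le> card (A + B)"
    using XB fin by (intro card_mono finite_set_plus) auto
  finally have card: "card X * card A \<le> card (A + B)" .
  have "y \<in> X + (A + uminus ` A)" if y: "y \<in> B" for y
  proof (cases "y \<in> X")
    case True
    obtain a where "a \<in> A" using ne by auto
    then have "a + - a \<in> A + uminus ` A" by blast
    then have "y + (a + - a) \<in> X + (A + uminus ` A)" using True by blast
    then show ?thesis by simp
  next
    case False
    then have "\<not> P (insert y X)" using max[of "insert y X"] by auto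
    then have "\<not> inj_on (\<lambda>(a, x). a + x) (A \<times> insert y X)"
      using XB y by (auto simp: P_def)
    then obtain q q' where q: "q \<in> A \<times> insert y X" "q' \<in> A \<times> insert y X" "q \<noteq> q'"
      "fst q + snd q = fst q' + snd q'"
      unfolding inj_on_def case_prod_unfold by blast
    have "\<not> (snd q \<in> X \<and> snd q' \<in> X)"
      using q inj_onD[OF inj, of q q'] by (auto simp: case_prod_unfold mem_Times_iff)
    moreover have "\<not> (snd q = y \<and> snd q' = y)"
      using q(3,4) by (auto simp: prod_eq_iff)
    ultimately have "snd q \<in> X \<and> snd q' = y \<or> snd q = y \<and> snd q' \<in> X"
      using q(1,2) by auto
    then obtain a a' x where ax: "a \<in> A" "a' \<in> A" "x \<in> X" "a + x = a' + y"
      using q by (metis mem_Times_iff)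
    then have "y = x + (a + - a')" by (simp add: algebra_simps)
    then show ?thesis using ax by blast
  qed
  then show thesis using that XB card by blast
qed

text \<open>\<open>S\<close> behaves like an approximate group: \<open>L\<close> bounds the number
  of translates, and \<open>M\<close> is the number of summands in the covering set. Ring operations
  on multipliers enlarge both, so both are parameters.\<close>

definition covered :: "'a::comm_ring set \<Rightarrow> real \<Rightarrow> nat \<Rightarrow> 'a \<Rightarrow> bool"
  where "covered S L M s \<longleftrightarrow> (\<exists>X. finite X \<and> real (card X) \<le> L \<and> s *o S \<subseteq> X + nsums M S)"

lemma card_set_plus_le: "finite A \<Longrightarrow> finite B \<Longrightarrow> card (A + B) \<le> card A * card B"
  by (metis set_plus_image card_image_le finite_cartesian_product card_cartesian_product)

lemma card_nsums_le: "finite X \<Longrightarrow> card (nsums n X) \<le> card X ^ n"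
  by (induction n) (auto intro!: order_trans[OF card_set_plus_le] finite_nsums)

lemma elt_set_times_image: "s *o A = (*) s ` A"
  by (auto simp: elt_set_times_def)

lemma finite_elt_set_times: "finite A \<Longrightarrow> finite (s *o A)"
  by (simp add: elt_set_times_image)

lemma card_elt_set_times_le: "finite A \<Longrightarrow> card (s *o A) \<le> card A"
  by (simp add: elt_set_times_image card_image_le)

lemma nsums_plus: "nsums n (A + B) = nsums n A + nsums n B"
  by (induction n) (simp_all add: ac_simps)

lemma nsums_nsums: "nsums n (nsums m A) = nsums (n * m) A"
  by (induction n) (simp_all add: nsums_add)

lemma nsums_mono_set: "A \<subseteq> B \<Longrightarrow> nsums n A \<subseteq> nsums n B"
  by (induction n) (simp_all add: set_plus_mono2)

lemma elt_set_times_nsums: "s *o nsums n A = nsums n (s *o (A :: 'a::comm_ring set))"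
  by (induction n) (simp_all add: set_times_plus_distrib2, simp add: elt_set_times_def)

lemma elt_set_times_plus_left: "(s + t) *o A \<subseteq> s *o A + t *o (A :: 'a::comm_ring set)"
  by (auto simp: elt_set_times_def set_plus_def distrib_right)

lemma elt_set_times_uminus: "(- s) *o A = s *o uminus ` (A :: 'a::comm_ring set)"
  by (auto simp: elt_set_times_image image_image)

lemma covered_mono:
  assumes "covered S L M s" "0 \<in> S" "L \<le> L'" "M \<le> M'"
  shows "covered S L' M' s"
proof -
  obtain X where "finite X" "real (card X) \<le> L" "s *o S \<subseteq> X + nsums M S"
    using assms(1) by (auto simp: covered_def)
  moreover have "X + nsums M S \<subseteq> X + nsums M' S"
    using nsums_mono[OF assms(2,4)] by (intro set_plus_mono2) auto
  ultimately show ?thesis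
    using assms(3) unfolding covered_def by (meson order_trans)
qed

lemma covered_add:
  assumes "covered S L M s" "covered S L' M' s'"
  shows "covered S (L * L') (M + M') (s + s')"
proof -
  obtain X X' where X: "finite X" "real (card X) \<le> L" "s *o S \<subseteq> X + nsums M S"
    and X': "finite X'" "real (card X') \<le> L'" "s' *o S \<subseteq> X' + nsums M' S"
    using assms by (auto simp: covered_def)
  have "(s + s') *o S \<subseteq> (X + nsums M S) + (X' + nsums M' S)"
    using elt_set_times_plus_left set_plus_mono2[OF X(3) X'(3)] by (rule order_trans)
  then have "(s + s') *o S \<subseteq> (X + X') + nsums (M + M') S"
    by (simp add: nsums_add ac_simps)
  moreover have "real (card (X + X')) \<le> real (card X) * real (card X')"
    using card_set_plus_le[OF X(1) X'(1)] by (simp flip: of_nat_mult)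
  moreover have "\<dots> \<le> L * L'"
    using X(2) X'(2) by (intro mult_mono) auto
  ultimately show ?thesis
    unfolding covered_def using finite_set_plus[OF X(1) X'(1)] by (meson order_trans)
qed

lemma covered_uminus: "covered S L M s \<Longrightarrow> uminus ` S = S \<Longrightarrow> covered S L M (- s)"
  by (simp add: covered_def elt_set_times_uminus)

text \<open>Cover the dilate by \<open>s'\<close> and multiply by \<open>s\<close>: a sum of
  \<open>M'\<close> copies of s S remains, and each copy is covered by \<open>L\<close> translates
  of M S. Hence the power of \<open>L\<close> and the product of the summand numbers.\<close>

lemma covered_mult:
  assumes "covered S L M s" "covered S L' M' s'"
  shows "covered S (L' * L ^ M') (M' * M) (s * s')"
proof -
  obtain X X' where X: "finite X" "real (card X) \<le> L" "s *o S \<subseteq> X + nsums M S"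
    and X': "finite X'" "real (card X') \<le> L'" "s' *o S \<subseteq> X' + nsums M' S"
    using assms by (auto simp: covered_def)
  have "(s * s') *o S \<subseteq> s *o X' + nsums M' (s *o S)"
    using set_times_mono[OF X'(3), of s]
    by (simp add: set_times_rearrange2 set_times_plus_distrib2 elt_set_times_nsums)
  also have "\<dots> \<subseteq> s *o X' + nsums M' (X + nsums M S)"
    using nsums_mono_set[OF X(3)] by (intro set_plus_mono2) auto
  also have "\<dots> = (s *o X' + nsums M' X) + nsums (M' * M) S"
    by (simp add: nsums_plus nsums_nsums add.assoc)
  finally have "(s * s') *o S \<subseteq> (s *o X' + nsums M' X) + nsums (M' * M) S" .
  moreover have fin: "finite (s *o X')" "finite (nsums M' X)"
    using X X' by (auto intro: finite_elt_set_times finite_nsums)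
  have "card (s *o X' + nsums M' X) \<le> card X' * card X ^ M'"
    using card_set_plus_le[OF fin] card_elt_set_times_le[OF X'(1), of s] card_nsums_le[OF X(1), of M']
    by (meson mult_le_mono order_trans)
  then have "real (card (s *o X' + nsums M' X)) \<le> real (card X') * real (card X) ^ M'"
    by (simp flip: of_nat_mult of_nat_power)
  moreover have "\<dots> \<le> L' * L ^ M'"
    using X(2) X'(2) by (intro mult_mono power_mono) auto
  ultimately show ?thesis
    unfolding covered_def using finite_set_plus[OF fin] by (meson order_trans)
qed

primrec ring_level :: "nat \<Rightarrow> 'a::comm_ring set \<Rightarrow> 'a set"
  where "ring_level 0 U = U"
  | "ring_level (Suc n) U = ring_level n U \<union> (ring_level n U + ring_level n U) \<union>
      (ring_level n U + uminus ` ring_level n U) \<union> ring_level n U * ring_level n U"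

text \<open>With M = 2^(2^n), the product rule turns L^c translates of M S into L^c (L^c)^M = L^(c
  (M + 1)) translates of M^2 S; the recursion tracks this exponent c.\<close>

primrec level_exponent :: "nat \<Rightarrow> nat"
  where "level_exponent 0 = 1"
  | "level_exponent (Suc n) = level_exponent n * (2 ^ 2 ^ n + 1)"

lemma covered_ring_level:
  fixes S U :: "'a::comm_ring set"
  assumes S: "0 \<in> S" "uminus ` S = S" and L: "L \<ge> 1"
    and U: "\<And>u. u \<in> U \<Longrightarrow> covered S L 2 u" and "x \<in> ring_level n U"
  shows "covered S (L ^ level_exponent n) (2 ^ 2 ^ n) x"
  using \<open>x \<in> ring_level n U\<close>
proof (induction n arbitrary: x)
  case 0
  then show ?case using U by simp
next
  case (Suc n)
  define c M where "c = level_exponent n" and "M = (2 ^ 2 ^ n :: nat)"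
  have M: "M \<ge> 2" unfolding M_def by (metis one_le_numeral one_le_power self_le_power le_antisym power_one_right power_increasing nat_le_linear)
  have cS: "level_exponent (Suc n) = c * (M + 1)" and MS: "2 ^ 2 ^ Suc n = M * M"
    by (simp_all add: c_def M_def flip: power_add)
  have IH: "covered S (L ^ c) M y" if "y \<in> ring_level n U" for y
    using Suc.IH[OF that] by (simp add: c_def M_def)
  have add: "covered S (L ^ (c * (M + 1))) (M * M) (y + z)"
    if "covered S (L ^ c) M y" "covered S (L ^ c) M z" for y z
  proof (rule covered_mono[OF covered_add[OF that] S(1)])
    \<comment> \<open>As M \<ge> 2, the cost of a sum fits into that of a product, so one bound
      serves all operations.\<close>
    have "c + c \<le> c * (M + 1)" using M by (simp add: algebra_simps)
    then show "L ^ c * L ^ c \<le> L ^ (c * (M + 1))"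
      unfolding power_add[symmetric] using L by (rule power_increasing)
    show "M + M \<le> M * M" using mult_le_mono1[OF M, of M] by (simp only: mult_2)
  qed
  from Suc.prems consider "x \<in> ring_level n U" | y z where "y \<in> ring_level n U" "z \<in> ring_level n U"
      "x = y + z \<or> x = y - z \<or> x = y * z"
    by (auto elim!: set_plus_elim set_times_elim)
  then have "covered S (L ^ (c * (M + 1))) (M * M) x"
  proof cases
    case 1
    show ?thesis
      by (rule covered_mono[OF IH[OF 1] S(1)]) (use M L in \<open>auto intro!: power_increasing\<close>)
  next
    case (2 y z)
    have "covered S (L ^ c * (L ^ c) ^ M) (M * M) (y * z)"
      by (rule covered_mult) (use 2 IH in auto)
    moreover have "L ^ c * (L ^ c) ^ M = L ^ (c * (M + 1))"
      by (simp add: power_add flip: power_mult)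
    ultimately have "covered S (L ^ (c * (M + 1))) (M * M) (y * z)"
      by simp
    moreover have "covered S (L ^ (c * (M + 1))) (M * M) (y + z)"
      using 2 IH by (intro add) auto
    moreover have "covered S (L ^ (c * (M + 1))) (M * M) (y - z)"
      using add[of y "- z"] 2 IH covered_uminus[OF _ S(2)] by simp
    ultimately show ?thesis using 2 by auto
  qed
  then show ?case by (simp only: cS MS)
qed

lemma card_square_le_collisions:
  assumes "finite X"
  shows "card X ^ 2 \<le> card (f ` X) * card {(x, y). x \<in> X \<and> y \<in> X \<and> f x = f y}"
proof -
  define N where "N z = card {x \<in> X. f x = z}" for z
  have cX: "card X = (\<Sum>z\<in>f ` X. N z)"
    unfolding N_def using assms by (subst card_eq_sum, subst sum.image_gen[of _ _ f]) auto
  have "{(x, y). x \<in> X \<and> y \<in> X \<and> f x = f y} = (\<Union>z\<in>f ` X. {x \<in> X. f x = z} \<times> {x \<in> X. f x = z})"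
    by auto
  also have "card \<dots> = (\<Sum>z\<in>f ` X. N z ^ 2)"
    using assms by (subst card_UN_disjoint) (auto simp: N_def card_cartesian_product power2_eq_square)
  finally have coll: "card {(x, y). x \<in> X \<and> y \<in> X \<and> f x = f y} = (\<Sum>z\<in>f ` X. N z ^ 2)" .
  have "(\<Sum>z\<in>f ` X. real (N z) * 1) ^ 2 \<le> (\<Sum>z\<in>f ` X. real (N z) ^ 2) * (\<Sum>z\<in>f ` X. 1 ^ 2)"
    by (rule Cauchy_Schwarz_ineq_sum)
  then have "real (card X ^ 2) \<le> real (card (f ` X) * card {(x, y). x \<in> X \<and> y \<in> X \<and> f x = f y})"
    by (simp add: cX coll mult.commute)
  then show ?thesis by (simp only: of_nat_le_iff)
qed

section \<open>A sum-product estimate in prime fields\<close>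

text \<open>The ambient ring need not be unital: \<open>F\<close> is a field whose unit \<open>e\<close> is merely an idempotent,
  and the last assumption says that \<open>F\<close> is a prime field.\<close>

locale finite_prime_subfield =
  fixes F :: "'a::comm_ring set" and e :: 'a
  assumes finite_F: "finite F"
    and zero_in: "0 \<in> F" and e_in: "e \<in> F" and e_nonzero: "e \<noteq> 0"
    and add_in: "x \<in> F \<Longrightarrow> y \<in> F \<Longrightarrow> x + y \<in> F"
    and uminus_in: "x \<in> F \<Longrightarrow> - x \<in> F"
    and mult_in: "x \<in> F \<Longrightarrow> y \<in> F \<Longrightarrow> x * y \<in> F"
    and e_mult: "x \<in> F \<Longrightarrow> e * x = x"
    and ex_inverse: "x \<in> F \<Longrightarrow> x \<noteq> 0 \<Longrightarrow> \<exists>y\<in>F. y * x = e"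
    and e_induct: "0 \<in> X \<Longrightarrow> (\<And>x. x \<in> F \<Longrightarrow> x \<in> X \<Longrightarrow> x + e \<in> X) \<Longrightarrow> F \<subseteq> X"
begin

lemma diff_in: "x \<in> F \<Longrightarrow> y \<in> F \<Longrightarrow> x - y \<in> F"
  using add_in[of x "- y"] uminus_in by simp

lemma mult_cancel:
  assumes "x \<in> F" "y \<in> F" "z \<in> F" "z \<noteq> 0" "z * x = z * y"
  shows "x = y"
proof -
  obtain w where "w \<in> F" "w * z = e" using ex_inverse[OF assms(3,4)] by auto
  then have "e * x = e * y"
    using assms(5) by (metis mult.assoc)
  then show ?thesis using e_mult assms by simp
qed

lemma inj_on_mult: "z \<in> F \<Longrightarrow> z \<noteq> 0 \<Longrightarrow> inj_on ((*) z) F"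
  using mult_cancel by (auto simp: inj_on_def)

lemma card_elt_set_times: "z \<in> F \<Longrightarrow> z \<noteq> 0 \<Longrightarrow> A \<subseteq> F \<Longrightarrow> card (z *o A) = card A"
  unfolding elt_set_times_image by (meson card_image inj_on_mult inj_on_subset)

lemma ring_level_subset: "U \<subseteq> F \<Longrightarrow> ring_level n U \<subseteq> F"
proof (induction n)
  case (Suc n)
  then have "ring_level n U \<subseteq> F" by simp
  then have level: "x \<in> F" if "x \<in> ring_level n U" for x
    using that by blast
  show ?case
    by (auto elim!: set_plus_elim set_times_elim intro: level add_in[OF level level]
        mult_in[OF level level] diff_in[OF level level])
qed simp

section \<open>Quotient sets and growth under ring operations\<close>

text \<open>The quotient set (S - S)/(S - S), expressed by an equation because the ambient ring has
  no division.\<close>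

definition quotients :: "'a set \<Rightarrow> 'a set"
  where "quotients S = {y \<in> F. \<exists>a\<in>S. \<exists>b\<in>S. \<exists>c\<in>S. \<exists>d\<in>S. c \<noteq> d \<and> y * (c - d) = a - b}"

lemma square_growth:
  assumes S: "S \<subseteq> F" and two: "card S \<ge> 2" and "quotients S \<noteq> F"
  obtains a b c d where "a \<in> S" "b \<in> S" "c \<in> S" "d \<in> S"
    "card ((\<lambda>(s, t). (c - d) * s + ((a - b) + (c - d)) * t) ` (S \<times> S)) = card S ^ 2"
proof -
  obtain s1 s2 where s12: "s1 \<in> S" "s2 \<in> S" "s1 \<noteq> s2"
    using two by (metis One_nat_def card_le_Suc0_iff_eq card.infinite not_less_eq_eq numeral_2_eq_2 zero_neq_numeral le_zero_eq)
  have "0 \<in> quotients S"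
    using s12 zero_in by (force simp: quotients_def)
  moreover have "quotients S \<subseteq> F" by (auto simp: quotients_def)
  ultimately obtain y where y: "y \<in> quotients S" "y + e \<notin> quotients S"
    using e_induct[of "quotients S"] \<open>quotients S \<noteq> F\<close> by blast
  then obtain a b c d where abcd: "a \<in> S" "b \<in> S" "c \<in> S" "d \<in> S" "c \<noteq> d" "y * (c - d) = a - b"
    and yF: "y \<in> F"
    by (auto simp: quotients_def)
  have yeF: "y + e \<in> F" using yF e_in add_in by simp
  have cd: "c - d \<in> F" "c - d \<noteq> 0" using abcd S by (auto intro: diff_in)
  \<comment> \<open>Multiplying the form s + (y + e) t by c - d leaves coefficients that are sums
    and differences of elements of \<open>S\<close>, so the values remain ring expressions of
    bounded depth.\<close>
  have co: "(a - b) + (c - d) = (c - d) * (y + e)"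
    using abcd(6) e_mult[OF cd(1)] by (simp add: distrib_left mult.commute)
  have co': "(a - b + (c - d)) * t = (c - d) * ((y + e) * t)" for t
    unfolding co by (rule mult.assoc)
  have "inj_on (\<lambda>(s, t). (c - d) * s + ((a - b) + (c - d)) * t) (S \<times> S)"
  proof (rule inj_onI, clarsimp)
    fix s t s' t'
    assume st: "s \<in> S" "t \<in> S" "s' \<in> S" "t' \<in> S"
      and eq: "(c - d) * s + (a - b + (c - d)) * t = (c - d) * s' + (a - b + (c - d)) * t'"
    have "(c - d) * (s + (y + e) * t) = (c - d) * (s' + (y + e) * t')"
      using eq unfolding co' by (simp only: distrib_left[of "c - d"])
    then have "s + (y + e) * t = s' + (y + e) * t'"
      by (rule mult_cancel[rotated -1]) (use st S cd yeF in \<open>auto intro!: add_in mult_in[OF yeF]\<close>)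
    then have eq': "(y + e) * (t - t') = s' - s"
      by (simp add: algebra_simps)
    have "t = t'"
    proof (rule ccontr)
      assume "t \<noteq> t'"
      then have "y + e \<in> quotients S"
        using eq' st yeF unfolding quotients_def by blast
      then show False using y by simp
    qed
    then show "s = s' \<and> t = t'" using eq' by simp
  qed
  then have "card ((\<lambda>(s, t). (c - d) * s + ((a - b) + (c - d)) * t) ` (S \<times> S)) = card S ^ 2"
    by (simp add: card_image card_cartesian_product power2_eq_square)
  then show thesis using that abcd by blast
qed

text \<open>Each squaring costs four levels: the differences, the sum (a - b) + (c - d), the two
  products, and the final sum. Once the quotients fill \<open>F\<close>, the set is kept.\<close>

lemma ring_level_growth:
  assumes U: "U \<subseteq> F" "card U \<ge> 2"
  shows "\<exists>S. S \<subseteq> ring_level (4 * j) U \<and> card S \<ge> 2 \<and> (quotients S = F \<or> card U ^ 2 ^ j \<le> card S)"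
proof (induction j)
  case 0
  then show ?case using U by auto
next
  case (Suc j)
  let ?E = "\<lambda>n. ring_level n U"
  have step: "?E n \<subseteq> ?E (Suc n)" "x \<in> ?E n \<Longrightarrow> y \<in> ?E n \<Longrightarrow> x + y \<in> ?E (Suc n)"
    "x \<in> ?E n \<Longrightarrow> y \<in> ?E n \<Longrightarrow> x - y \<in> ?E (Suc n)"
    "x \<in> ?E n \<Longrightarrow> y \<in> ?E n \<Longrightarrow> x * y \<in> ?E (Suc n)" for n x y
    by (auto intro: diff_in_set_plus)
  have four: "4 * Suc j = Suc (Suc (Suc (Suc (4 * j))))" by simp
  have mono: "?E n \<subseteq> ?E (n + k)" for n k
    by (induction k) (use step(1) in \<open>auto simp del: ring_level.simps\<close>)
  obtain S where S: "S \<subseteq> ?E (4 * j)" "card S \<ge> 2" "quotients S = F \<or> card U ^ 2 ^ j \<le> card S"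
    using Suc.IH by blast
  show ?case
  proof (cases "quotients S = F")
    case True
    have "S \<subseteq> ?E (4 * Suc j)"
      using S(1) mono[of "4 * j" 4] by (simp add: add.commute)
    then show ?thesis using S(2) True by blast
  next
    case False
    have SF: "S \<subseteq> F" using S(1) ring_level_subset[OF U(1)] by blast
    obtain a b c d where abcd: "a \<in> S" "b \<in> S" "c \<in> S" "d \<in> S"
      "card ((\<lambda>(s, t). (c - d) * s + ((a - b) + (c - d)) * t) ` (S \<times> S)) = card S ^ 2"
      using square_growth[OF SF S(2) False] .
    define S' where "S' = (\<lambda>(s, t). (c - d) * s + ((a - b) + (c - d)) * t) ` (S \<times> S)"
    have "S' \<subseteq> ?E (4 * Suc j)"
      unfolding four
    proof
      fix x assume "x \<in> S'"
      then obtain s t where st: "s \<in> S" "t \<in> S" and x: "x = (c - d) * s + ((a - b) + (c - d)) * t"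
        by (auto simp: S'_def)
      let ?n = "4 * j"
      have in0: "a \<in> ?E ?n" "b \<in> ?E ?n" "c \<in> ?E ?n" "d \<in> ?E ?n" "s \<in> ?E ?n" "t \<in> ?E ?n"
        using abcd st S(1) by auto
      have cd1: "c - d \<in> ?E (Suc ?n)" and ab1: "a - b \<in> ?E (Suc ?n)"
        using in0 by (auto intro: step simp del: ring_level.simps)
      have "(a - b) + (c - d) \<in> ?E (Suc (Suc ?n))"
        by (rule step(2)[OF ab1 cd1])
      moreover have "t \<in> ?E (Suc (Suc ?n))" "s \<in> ?E (Suc (Suc ?n))" "c - d \<in> ?E (Suc (Suc ?n))"
        using in0 cd1 step(1) by blast+
      ultimately have "(c - d) * s \<in> ?E (Suc (Suc (Suc ?n)))" "((a - b) + (c - d)) * t \<in> ?E (Suc (Suc (Suc ?n)))"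
        by (auto intro: step(4) simp del: ring_level.simps)
      then show "x \<in> ?E (Suc (Suc (Suc (Suc ?n))))"
        unfolding x by (rule step(2))
    qed
    moreover have "card S' = card S ^ 2" using abcd(5) by (simp add: S'_def)
    moreover have "card U ^ 2 ^ Suc j \<le> card S ^ 2"
      using S(3) False power_mono[of "card U ^ 2 ^ j" "card S" 2] by (simp add: power_mult[symmetric] mult.commute)
    moreover have "card S ^ 2 \<ge> 2"
      using S(2) self_le_power[of "card S" 2] by linarith
    ultimately show ?thesis by metis
  qed
qed

text \<open>A set with card U ^ 2 ^ j elements would not fit into \<open>F\<close>, so the growth
  must have stopped because the quotients fill \<open>F\<close>. The extra level is for numerator
  and denominator, which are differences.\<close>

lemma quotient_representation:
  assumes U: "U \<subseteq> F" "card U \<ge> 2" and big: "card F < card U ^ 2 ^ j" and y: "y \<in> F"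
  obtains u v where "u \<in> ring_level (4 * j + 1) U" "v \<in> ring_level (4 * j + 1) U"
    "v \<noteq> 0" "y * v = u"
proof -
  obtain S where S: "S \<subseteq> ring_level (4 * j) U" "quotients S = F \<or> card U ^ 2 ^ j \<le> card S"
    using ring_level_growth[OF U] by blast
  have "card S \<le> card F"
    using S(1) ring_level_subset[OF U(1)] finite_F by (intro card_mono) auto
  then have "y \<in> quotients S" using S(2) big y by auto
  then obtain a b c d where "a \<in> S" "b \<in> S" "c \<in> S" "d \<in> S" "c \<noteq> d" "y * (c - d) = a - b"
    by (auto simp: quotients_def)
  moreover from this have "a - b \<in> ring_level (4 * j + 1) U" "c - d \<in> ring_level (4 * j + 1) U"
    using S(1) by (auto intro!: diff_in_set_plus)
  ultimately show thesis using that[of "a - b" "c - d"] by simp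
qed

text \<open>Averaging over \<open>y\<close> the number of solutions of \<open>a + y b = c + y d\<close> in \<open>S\<close>: a solution with
  \<open>b \<noteq> d\<close> determines \<open>y\<close>.\<close>

lemma dilate_sums_bound:
  assumes S: "S \<subseteq> F" "S \<noteq> {}" and Q: "\<And>y. y \<in> F \<Longrightarrow> real (card (S + y *o S)) \<le> Q"
  shows "real (card F) * real (card S) ^ 2 \<le> Q * (real (card S) ^ 2 + real (card F))"
proof -
  have finS: "finite S" using S finite_F finite_subset by blast
  define s where "s = real (card S)"
  have s: "s > 0" using finS S by (simp add: s_def card_gt_0_iff)
  have Q0: "Q \<ge> 0" using Q[OF zero_in] by (meson of_nat_0_le_iff order_trans)
  define C where "C y = {(p, q). p \<in> S \<times> S \<and> q \<in> S \<times> S \<and> fst p + y * snd p = fst q + y * snd q}" for y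
  have finC: "finite (C y)" for y
    by (rule finite_subset[of _ "(S \<times> S) \<times> (S \<times> S)"]) (auto simp: C_def finS)
  \<comment> \<open>Cauchy-Schwarz over the values of a + y b: few values force many
    collisions.\<close>
  have C: "s ^ 4 \<le> Q * card (C y)" if "y \<in> F" for y
  proof -
    have "card (S \<times> S) ^ 2 \<le> card ((\<lambda>p. fst p + y * snd p) ` (S \<times> S)) * card (C y)"
      unfolding C_def by (rule card_square_le_collisions) (simp add: finS)
    also have "(\<lambda>p. fst p + y * snd p) ` (S \<times> S) = S + y *o S"
      unfolding set_plus_image elt_set_times_image map_prod_surj_on[OF image_ident refl, symmetric]
      by (simp add: image_image case_prod_unfold)
    finally have "real (card (S \<times> S) ^ 2) \<le> real (card (S + y *o S)) * real (card (C y))"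
      by (simp only: of_nat_le_iff of_nat_mult[symmetric])
    also have "\<dots> \<le> Q * card (C y)"
      using Q[OF that] by (intro mult_right_mono) auto
    finally show ?thesis by (simp add: card_cartesian_product s_def power2_eq_square power4_eq_xxxx mult.assoc)
  qed
  define P where "P = {(p, q). p \<in> S \<times> S \<and> q \<in> S \<times> S \<and> snd p \<noteq> snd q}"
  define P' where "P' = {(p, q). p \<in> S \<times> S \<and> q = p}"
  have finP: "finite P" "finite P'"
    by (rule finite_subset[of _ "(S \<times> S) \<times> (S \<times> S)"], auto simp: P_def P'_def finS)+
  have "card P \<le> card ((S \<times> S) \<times> (S \<times> S))"
    by (rule card_mono) (auto simp: P_def finS)
  then have cP: "card P \<le> card S ^ 4"
    by (simp add: card_cartesian_product power4_eq_xxxx mult.assoc)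
  have "P' = (\<lambda>p. (p, p)) ` (S \<times> S)" by (auto simp: P'_def)
  then have cP': "card P' = card S ^ 2"
    by (simp add: card_image inj_on_def card_cartesian_product power2_eq_square)
  \<comment> \<open>A solution with equal second entries also has equal first entries, so for each
    \<open>y\<close> only the |S|^2 diagonal solutions lie outside \<open>P\<close>.\<close>
  have "(SIGMA y:F. C y) \<subseteq> {(y, r). y \<in> F \<and> r \<in> P \<and> r \<in> C y} \<union> F \<times> P'"
    by (auto simp: C_def P_def P'_def)
  then have "card (SIGMA y:F. C y) \<le> card ({(y, r). y \<in> F \<and> r \<in> P \<and> r \<in> C y} \<union> F \<times> P')"
    by (rule card_mono[rotated])
      (use finP finite_F in \<open>auto intro: finite_subset[of _ "F \<times> P"]\<close>)
  also have "\<dots> \<le> card {(y, r). y \<in> F \<and> r \<in> P \<and> r \<in> C y} + card (F \<times> P')"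
    by (rule card_Un_le)
  also have "card {(y, r). y \<in> F \<and> r \<in> P \<and> r \<in> C y} \<le> card P"
  proof (rule card_inj_on_le[where f = snd])
    show "inj_on snd {(y, r). y \<in> F \<and> r \<in> P \<and> r \<in> C y}"
    proof (rule inj_onI, clarsimp)
      fix y y' a b c d
      assume y: "y \<in> F" "y' \<in> F" and P: "((a, b), c, d) \<in> P"
        and "((a, b), c, d) \<in> C y" "((a, b), c, d) \<in> C y'"
      then have "a + y * b = c + y * d" "a + y' * b = c + y' * d" by (auto simp: C_def)
      then have "y * (b - d) = c - a" "y' * (b - d) = c - a" by (auto simp: algebra_simps)
      then have "(b - d) * y = (b - d) * y'" by (simp add: mult.commute)
      moreover have "b - d \<in> F" "b - d \<noteq> 0" using P S by (auto simp: P_def intro: diff_in)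
      ultimately show "y = y'" using mult_cancel y by blast
    qed
  qed (use finP in auto)
  finally have "card (SIGMA y:F. C y) \<le> card P + card (F \<times> P')" by simp
  then have "(\<Sum>y\<in>F. card (C y)) \<le> card S ^ 4 + card F * card S ^ 2"
    using cP cP' finite_F finC by (simp add: card_cartesian_product)
  then have "real (\<Sum>y\<in>F. card (C y)) \<le> real (card S ^ 4 + card F * card S ^ 2)"
    by (simp only: of_nat_le_iff)
  then have sumC: "(\<Sum>y\<in>F. real (card (C y))) \<le> s ^ 4 + card F * s ^ 2"
    by (simp add: s_def)
  have "real (card F) * s ^ 4 = (\<Sum>y\<in>F. s ^ 4)" by simp
  also have "\<dots> \<le> (\<Sum>y\<in>F. Q * card (C y))" by (intro sum_mono C)
  also have "\<dots> \<le> Q * (s ^ 4 + card F * s ^ 2)"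
    unfolding sum_distrib_left[symmetric] using sumC Q0 by (rule mult_left_mono)
  finally have "(real (card F) * s ^ 2) * s ^ 2 \<le> (Q * (s ^ 2 + card F)) * s ^ 2"
    by (simp add: algebra_simps power2_eq_square power4_eq_xxxx)
  then have "real (card F) * s ^ 2 \<le> Q * (s ^ 2 + card F)"
    by (rule mult_right_le_imp_le) (use s in simp)
  then show ?thesis by (simp add: s_def)
qed

text \<open>Write y = u/v with u and v of bounded ring depth. Dilation by v \<noteq> 0 preserves
  cardinality and maps S + y S onto v S + u S, whose two summands are each covered by translates of
  an iterated sumset; hence the factor 2 in the exponent and in the number of summands.\<close>

lemma covered_field_bound:
  assumes S: "S \<subseteq> F" "0 \<in> S" "uminus ` S = S"
    and U: "U \<subseteq> F" "card U \<ge> 2" "card F < card U ^ 2 ^ j"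
    and L: "L \<ge> 1" "\<And>u. u \<in> U \<Longrightarrow> covered S L 2 u"
  shows "real (card F) * real (card S) ^ 2 \<le>
    (L ^ (2 * level_exponent (4 * j + 1)) * real (card (nsums (2 * 2 ^ 2 ^ (4 * j + 1)) S))) *
    (real (card S) ^ 2 + real (card F))"
proof (rule dilate_sums_bound)
  fix y assume y: "y \<in> F"
  define c M where "c = level_exponent (4 * j + 1)" and "M = (2 ^ 2 ^ (4 * j + 1) :: nat)"
  obtain u v where uv: "u \<in> ring_level (4 * j + 1) U" "v \<in> ring_level (4 * j + 1) U"
    "v \<noteq> 0" "y * v = u"
    using quotient_representation[OF U y] .
  have finS: "finite S" using S finite_F finite_subset by blast
  have "covered S (L ^ c) M u" "covered S (L ^ c) M v"
    unfolding c_def M_def using covered_ring_level[OF S(2,3) L] uv by blast+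
  then obtain X Y where X: "finite X" "real (card X) \<le> L ^ c" "u *o S \<subseteq> X + nsums M S"
    and Y: "finite Y" "real (card Y) \<le> L ^ c" "v *o S \<subseteq> Y + nsums M S"
    by (auto simp: covered_def)
  have vF: "v \<in> F" using uv ring_level_subset[OF U(1)] by blast
  have "S + y *o S \<subseteq> F"
    using S y by (auto elim!: set_plus_elim simp: elt_set_times_def intro!: add_in mult_in)
  then have "card (S + y *o S) = card (v *o (S + y *o S))"
    using card_elt_set_times[OF vF uv(3)] by simp
  also have "v *o (S + y *o S) = v *o S + u *o S"
    using uv(4) by (simp add: set_times_plus_distrib2 set_times_rearrange2 mult.commute)
  finally have eq: "card (S + y *o S) = card (v *o S + u *o S)" .
  have "v *o S + u *o S \<subseteq> (Y + nsums M S) + (X + nsums M S)"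
    using X Y by (intro set_plus_mono2)
  also have "\<dots> = (Y + X) + nsums (2 * M) S"
    by (simp only: mult_2 nsums_add add_ac)
  finally have sub: "v *o S + u *o S \<subseteq> (Y + X) + nsums (2 * M) S" .
  have fin: "finite (Y + X)" "finite (nsums (2 * M) S)"
    using X Y finS by (auto intro: finite_set_plus finite_nsums)
  have "card (S + y *o S) \<le> card ((Y + X) + nsums (2 * M) S)"
    unfolding eq using card_mono[OF finite_set_plus[OF fin] sub] .
  also have "\<dots> \<le> (card Y * card X) * card (nsums (2 * M) S)"
    using card_set_plus_le[OF fin] card_set_plus_le[OF Y(1) X(1)]
    by (meson mult_le_mono1 order_trans)
  finally have "real (card (S + y *o S)) \<le> (real (card Y) * real (card X)) * real (card (nsums (2 * M) S))"
    by (simp flip: of_nat_mult)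
  also have "\<dots> \<le> (L ^ c * L ^ c) * real (card (nsums (2 * M) S))"
    using X Y L(1) by (intro mult_right_mono mult_mono) auto
  finally show "real (card (S + y *o S)) \<le> L ^ (2 * level_exponent (4 * j + 1)) *
      real (card (nsums (2 * 2 ^ 2 ^ (4 * j + 1)) S))"
    by (simp only: c_def M_def mult_2[of "level_exponent _"] power_add)
qed (use S in auto)

end

section \<open>From near-invariance under dilations to a dichotomy of sizes\<close>

text \<open>The exponents of \<open>K\<close> collected in \<open>sum_product_dichotomy\<close>. Two
  coverings, each with \<open>L\<close> = K^160, give the 320; the sumset bound K^(49 n + 24) at n =
  2 M gives 98 M + 24; passing from |B| to |S| costs 1. The last 25 covers a factor 2 and the
  passage from |S| to |A|.\<close>

definition sum_product_exponent :: "nat \<Rightarrow> nat"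
  where "sum_product_exponent j =
    320 * level_exponent (4 * j + 1) + 98 * 2 ^ 2 ^ (4 * j + 1) + 50"

text \<open>The intersection D of h B and h0 B is a bridge between the two dilations. As D lies in h
  B, few translates of D - D cover h S; as D lies in h0 B, D - D lies in h0 (B - B), and B - B is
  covered by few translates of S + S. Multiplying by \<open>k0\<close>, the inverse of
  \<open>h0\<close>, removes h0.\<close>

lemma (in finite_prime_subfield) covered_ratio:
  fixes K :: real
  assumes BF: "B \<subseteq> F" and S: "S \<subseteq> F" "uminus ` S = S" "S \<noteq> {}"
    and h: "h \<in> F" "h0 \<in> F" "h0 \<noteq> 0" "k0 \<in> F" "k0 * h0 = e" and K: "K \<ge> 0"
    and sums: "real (card ((B + uminus ` B) + S)) \<le> K * card (h *o B \<inter> h0 *o B)"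
      "real (card ((B + uminus ` B) + S)) \<le> K * card S"
    and meet: "h *o B \<inter> h0 *o B \<noteq> {}"
  shows "covered S (K * K) 2 (k0 * h)"
proof -
  let ?D = "h *o B \<inter> h0 *o B" and ?BB = "B + uminus ` B"
  have fin: "finite B" "finite S" using BF S finite_F finite_subset by blast+
  have finD: "finite ?D" using fin by (auto intro: finite_elt_set_times)
  have finBB: "finite ?BB" using fin by (intro finite_set_plus) auto
  obtain b where b: "b \<in> B" using meet by (auto simp: elt_set_times_def)
  obtain X where X: "X \<subseteq> h *o S" "card X * card ?D \<le> card (?D + h *o S)"
    "h *o S \<subseteq> X + (?D + uminus ` ?D)"
    using Ruzsa_covering[OF finD finite_elt_set_times[OF fin(2)] meet] .
  have "?D + h *o S \<subseteq> h *o (B + S)"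
    unfolding set_times_plus_distrib2 by (rule set_plus_mono2) auto
  then have "card (?D + h *o S) \<le> card (h *o (B + S))"
    using fin by (intro card_mono finite_elt_set_times finite_set_plus)
  also have "\<dots> \<le> card (B + S)"
    using fin by (intro card_elt_set_times_le finite_set_plus)
  \<comment> \<open>Translation by -b embeds B + S into the sumset whose size is controlled.\<close>
  also have "\<dots> \<le> card (?BB + S)"
  proof (rule card_inj_on_le[where f = "\<lambda>z. z + - b"])
    show "(\<lambda>z. z + - b) ` (B + S) \<subseteq> ?BB + S"
    proof
      fix z assume "z \<in> (\<lambda>z. z + - b) ` (B + S)"
      then obtain x s where "x \<in> B" "s \<in> S" "z = (x - b) + s"
        by (auto elim!: set_plus_elim simp: algebra_simps)
      then show "z \<in> ?BB + S" using b by (auto intro!: set_plus_intro diff_in_set_plus)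
    qed
  qed (use fin finBB in \<open>auto simp: inj_on_def intro: finite_set_plus\<close>)
  finally have "card X * card ?D \<le> card (?BB + S)" using X(2) by simp
  then have "real (card X) * card ?D \<le> K * card ?D"
    using sums(1) by (simp flip: of_nat_mult)
  then have cX: "real (card X) \<le> K"
    by (rule mult_right_le_imp_le) (use meet finD in \<open>simp add: card_gt_0_iff\<close>)
  obtain Y where Y: "Y \<subseteq> ?BB" "card Y * card S \<le> card (S + ?BB)"
    "?BB \<subseteq> Y + (S + uminus ` S)"
    using Ruzsa_covering[OF fin(2) finBB S(3)] .
  have "real (card Y) * card S \<le> K * card S"
    using Y(2) sums(2) by (simp add: add.commute flip: of_nat_mult)
  then have cY: "real (card Y) \<le> K"
    by (rule mult_right_le_imp_le) (use S fin in \<open>simp add: card_gt_0_iff\<close>)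
  have finXY: "finite X" "finite Y"
    using X(1) Y(1) finBB fin by (auto intro: finite_subset finite_elt_set_times)
  have "uminus ` ?D \<subseteq> h0 *o uminus ` B"
    by (auto simp: elt_set_times_def)
  then have "?D + uminus ` ?D \<subseteq> h0 *o ?BB"
    unfolding set_times_plus_distrib2 by (intro set_plus_mono2) auto
  also have "\<dots> \<subseteq> h0 *o (Y + nsums 2 S)"
    using Y(3) S(2) by (intro set_times_mono) (simp add: numeral_2_eq_2)
  finally have "h *o S \<subseteq> X + h0 *o (Y + nsums 2 S)"
    using X(3) set_plus_mono2[OF subset_refl] by (meson order_trans)
  then have "k0 *o (h *o S) \<subseteq> k0 *o (X + h0 *o (Y + nsums 2 S))"
    by (rule set_times_mono)
  also have "\<dots> = (k0 *o X + e *o Y) + e *o nsums 2 S"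
    by (simp add: set_times_plus_distrib2 set_times_rearrange2 h(5) add.assoc)
  also have "e *o nsums 2 S = nsums 2 S"
  proof -
    have "e * x = x" if "x \<in> S" for x using that S(1) e_mult by blast
    then have "e *o S = S" by (auto simp: elt_set_times_def)
    then show ?thesis by (simp add: elt_set_times_nsums)
  qed
  finally have "(k0 * h) *o S \<subseteq> (k0 *o X + e *o Y) + nsums 2 S"
    by (simp add: set_times_rearrange2)
  moreover have "card (k0 *o X + e *o Y) \<le> card X * card Y"
    using card_set_plus_le[of "k0 *o X" "e *o Y"] finXY
      card_elt_set_times_le[OF finXY(1), of k0] card_elt_set_times_le[OF finXY(2), of e]
    by (meson finite_elt_set_times mult_le_mono order_trans)
  then have "real (card (k0 *o X + e *o Y)) \<le> real (card X) * real (card Y)"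
    by (simp flip: of_nat_mult)
  then have "real (card (k0 *o X + e *o Y)) \<le> K * K"
    using mult_mono[OF cX cY K] by simp
  moreover have "finite (k0 *o X + e *o Y)"
    using finXY by (intro finite_set_plus finite_elt_set_times)
  ultimately show ?thesis unfolding covered_def by blast
qed

text \<open>A second moment argument: sets of size b inside a set of size K b overlap in at least
  b/K elements on average. Some \<open>h0\<close> attains this average, and the h whose overlap with
  it is below b/(2K) contribute at most half of it.\<close>

lemma exists_common_dilate:
  fixes f :: "'b \<Rightarrow> 'c set" and K :: real and b :: nat
  assumes fin: "finite V" "finite D" and ne: "V \<noteq> {}" and K: "K > 0" and b: "b > 0"
    and sub: "\<And>h. h \<in> V \<Longrightarrow> f h \<subseteq> D" and card_f: "\<And>h. h \<in> V \<Longrightarrow> card (f h) = b"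
    and D: "real (card D) \<le> K * b"
  obtains h0 where "h0 \<in> V"
    "real (card V) \<le> 2 * K * card {h \<in> V. real b \<le> 2 * K * card (f h \<inter> f h0)}"
proof -
  define n where "n = real (card V)"
  have n: "n > 0" using fin ne by (simp add: n_def card_gt_0_iff)
  have finf: "finite (f h)" if "h \<in> V" for h using sub[OF that] fin finite_subset by blast
  have "real (card (SIGMA h:V. f h)) = n * b"
    using fin finf by (simp add: card_f n_def)
  moreover have "snd ` (SIGMA h:V. f h) \<subseteq> D"
    using sub by fastforce
  then have "card (snd ` (SIGMA h:V. f h)) \<le> card D"
    by (rule card_mono[OF fin(2)])
  \<comment> \<open>Two incidences with the same point are a triple (h, h', x) with x in both sets,
    so Cauchy-Schwarz for collisions bounds the total overlap from below.\<close>
  moreover have "{(p, q). p \<in> (SIGMA h:V. f h) \<and> q \<in> (SIGMA h:V. f h) \<and> snd p = snd q} =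
    (\<lambda>(h, h', x). ((h', x), (h, x))) ` (SIGMA h:V. SIGMA h':V. f h' \<inter> f h)"
    by (auto simp: image_iff)
  then have "card {(p, q). p \<in> (SIGMA h:V. f h) \<and> q \<in> (SIGMA h:V. f h) \<and> snd p = snd q} \<le>
     card (SIGMA h:V. SIGMA h':V. f h' \<inter> f h)"
    using fin finf by (simp only:) (intro card_image_le finite_SigmaI finite_Int; simp)
  moreover have "card (SIGMA h:V. f h) ^ 2 \<le> card (snd ` (SIGMA h:V. f h)) *
      card {(p, q). p \<in> (SIGMA h:V. f h) \<and> q \<in> (SIGMA h:V. f h) \<and> snd p = snd q}"
    using fin finf by (intro card_square_le_collisions) auto
  ultimately have "(n * b) ^ 2 \<le> real (card D) * real (card (SIGMA h:V. SIGMA h':V. f h' \<inter> f h))"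
  proof -
    assume le: "real (card (SIGMA h:V. f h)) = n * b" "card (snd ` (SIGMA h:V. f h)) \<le> card D"
      "card {(p, q). p \<in> (SIGMA h:V. f h) \<and> q \<in> (SIGMA h:V. f h) \<and> snd p = snd q} \<le>
        card (SIGMA h:V. SIGMA h':V. f h' \<inter> f h)"
      "card (SIGMA h:V. f h) ^ 2 \<le> card (snd ` (SIGMA h:V. f h)) *
        card {(p, q). p \<in> (SIGMA h:V. f h) \<and> q \<in> (SIGMA h:V. f h) \<and> snd p = snd q}"
    have "card (SIGMA h:V. f h) ^ 2 \<le> card D * card (SIGMA h:V. SIGMA h':V. f h' \<inter> f h)"
      using le(4) mult_le_mono[OF le(2,3)] by (rule order_trans)
    then have "real (card (SIGMA h:V. f h) ^ 2) \<le>
        real (card D * card (SIGMA h:V. SIGMA h':V. f h' \<inter> f h))"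
      by (simp only: of_nat_le_iff)
    then show ?thesis unfolding of_nat_mult of_nat_power le(1) .
  qed
  also have "card (SIGMA h:V. SIGMA h':V. f h' \<inter> f h) = (\<Sum>h\<in>V. \<Sum>h'\<in>V. card (f h' \<inter> f h))"
    using fin finf by simp
  also have "real (card D) * real (\<Sum>h\<in>V. \<Sum>h'\<in>V. card (f h' \<inter> f h)) \<le>
      (K * b) * (\<Sum>h\<in>V. \<Sum>h'\<in>V. real (card (f h' \<inter> f h)))"
    using D by (simp add: mult_right_mono sum_nonneg)
  finally have "b * (n * n * b) \<le> b * (K * (\<Sum>h\<in>V. \<Sum>h'\<in>V. real (card (f h' \<inter> f h))))"
    by (simp add: power2_eq_square algebra_simps)
  then have main: "n * n * b \<le> K * (\<Sum>h\<in>V. \<Sum>h'\<in>V. real (card (f h' \<inter> f h)))"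
    using b by (simp add: mult_le_cancel_left)
  have "\<exists>h0\<in>V. n * b \<le> K * (\<Sum>h'\<in>V. real (card (f h' \<inter> f h0)))"
  proof (rule ccontr)
    assume "\<not> ?thesis"
    then have "(\<Sum>h\<in>V. K * (\<Sum>h'\<in>V. real (card (f h' \<inter> f h)))) < (\<Sum>h\<in>V. n * b)"
      using fin ne by (intro sum_strict_mono) auto
    then show False using main by (simp add: sum_distrib_left n_def mult.assoc)
  qed
  then obtain h0 where h0: "h0 \<in> V" "n * b \<le> K * (\<Sum>h'\<in>V. real (card (f h' \<inter> f h0)))" by blast
  define W where "W = {h \<in> V. real b \<le> 2 * K * card (f h \<inter> f h0)}"
  have "(\<Sum>h'\<in>V. real (card (f h' \<inter> f h0))) =
    (\<Sum>h'\<in>W. real (card (f h' \<inter> f h0))) + (\<Sum>h'\<in>V - W. real (card (f h' \<inter> f h0)))"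
    by (subst sum.subset_diff[of W V]) (auto simp: W_def fin)
  also have "\<dots> \<le> (\<Sum>h'\<in>W. real b) + (\<Sum>h'\<in>V - W. b / (2 * K))"
  proof (intro add_mono sum_mono)
    fix h' assume "h' \<in> W"
    then have "card (f h' \<inter> f h0) \<le> card (f h')"
      using finf by (intro card_mono) (auto simp: W_def)
    then show "real (card (f h' \<inter> f h0)) \<le> real b"
      using card_f \<open>h' \<in> W\<close> by (simp add: W_def)
  qed (use K in \<open>auto simp: W_def field_simps\<close>)
  also have "\<dots> \<le> card W * b + n * (b / (2 * K))"
  proof -
    have "real (card (V - W)) \<le> n" using fin by (auto simp: n_def intro: card_mono)
    then show ?thesis using b K by (simp add: mult_right_mono divide_right_mono)
  qed
  finally have "n * b \<le> K * (card W * b + n * (b / (2 * K)))"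
    using h0(2) K by (meson mult_left_mono order_trans less_imp_le)
  also have "\<dots> = (K * card W + n / 2) * b"
    using K by (simp add: field_simps)
  finally have "n \<le> K * card W + n / 2"
    by (rule mult_right_le_imp_le) (use b in simp)
  then have "n \<le> 2 * K * card W" by simp
  then show thesis using that h0(1) by (simp add: n_def W_def)
qed

text \<open>In the application \<open>A\<close> and \<open>D\<close> are consecutive spectra and
  \<open>V\<close> consists of powers of \<open>g\<close>. The single parameter K \<ge> 2 absorbs
  every numerical constant as a power of itself, so that only exponents are tracked.\<close>

theorem (in finite_prime_subfield) sum_product_dichotomy:
  fixes K :: real
  assumes VF: "V \<subseteq> F" "0 \<notin> V" and AF: "A \<subseteq> F" "A \<noteq> {}" and D: "finite D" and K: "K \<ge> 2"
    and sub: "\<And>h. h \<in> V \<Longrightarrow> h *o A \<subseteq> D"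
    and cD: "real (card D) \<le> K * card A"
    and diffs: "real (card A) ^ 2 \<le> K * card {(x, y). x \<in> A \<and> y \<in> A \<and> x - y \<in> D}"
    and V: "2 * K ^ 7 \<le> card V" "real (card F) < (card V / K ^ 7) ^ 2 ^ j"
  shows "real (card A) \<le> K ^ sum_product_exponent j \<or>
    real (card F) \<le> K ^ sum_product_exponent j * card A"
proof -
  have finA: "finite A" and finV: "finite V" using AF VF finite_F finite_subset by blast+
  define a where "a = real (card A)"
  have a: "a > 0" using finA AF by (simp add: a_def card_gt_0_iff)
  have K1: "K \<ge> 1" using K by simp
  have pow2: "2 ^ m \<le> K ^ m" for m using K by (intro power_mono) auto
  have pow_mono: "K ^ m \<le> K ^ n" if "m \<le> n" for m n using K that by (intro power_increasing) auto
  have "a ^ 2 \<le> K * (\<Sum>d\<in>D. real (reps A d))"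
    using diffs sum_reps[OF finA D] by (simp add: a_def flip: of_nat_sum)
  \<comment> \<open>Cauchy-Schwarz over \<open>D\<close> turns a count of differences into energy:
    K^2 comes from squaring, and one more K from the size of \<open>D\<close>.\<close>
  then have "(a ^ 2) ^ 2 \<le> (K * (\<Sum>d\<in>D. real (reps A d))) ^ 2"
    by (rule power_mono) simp
  also have "\<dots> = K ^ 2 * (\<Sum>d\<in>D. real (reps A d) * 1) ^ 2"
    by (simp add: power_mult_distrib)
  also have "\<dots> \<le> K ^ 2 * ((\<Sum>d\<in>D. real (reps A d) ^ 2) * (\<Sum>d\<in>D. 1 ^ 2))"
    by (intro mult_left_mono Cauchy_Schwarz_ineq_sum) simp
  also have "\<dots> \<le> K ^ 2 * ((\<Sum>d\<in>D. real (reps A d) ^ 2) * (K * a))"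
    using cD by (intro mult_left_mono) (auto simp: a_def sum_nonneg)
  finally have "a * a ^ 3 \<le> a * (K ^ 3 * (\<Sum>d\<in>D. real (reps A d) ^ 2))"
    by (simp add: power2_eq_square power3_eq_cube algebra_simps)
  then have "a ^ 3 \<le> K ^ 3 * (\<Sum>d\<in>D. real (reps A d) ^ 2)"
    using a by (simp add: mult_le_cancel_left)
  moreover have "K ^ 3 > 0" using K by simp
  ultimately obtain B where B: "B \<subseteq> A" "a \<le> 4 * K ^ 3 * card B"
    "real (card (B + uminus ` B)) \<le> 4096 * (K ^ 3) ^ 4 * card B"
    using Balog_Szemeredi_Gowers[OF finA D AF(2)] unfolding a_def by blast
  define b where "b = real (card B)"
  have BF: "B \<subseteq> F" using B(1) AF by auto
  have finB: "finite B" using B(1) finA finite_subset by blast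
  have neB: "B \<noteq> {}" using B(2) a by auto
  have b: "b > 0" using finB neB by (simp add: b_def card_gt_0_iff)
  have ab: "a \<le> K ^ 5 * b"
  proof -
    have "4 * K ^ 3 \<le> K ^ 2 * K ^ 3" using pow2[of 2] K by (intro mult_right_mono) auto
    also have "\<dots> = K ^ 5" by (simp flip: power_add)
    finally have "4 * K ^ 3 * b \<le> K ^ 5 * b" using b by (intro mult_right_mono) auto
    then show ?thesis using B(2) by (simp add: b_def)
  qed
  have BB: "real (card (B + uminus ` B)) \<le> K ^ 24 * b"
  proof -
    \<comment> \<open>4096 = 2^12 is absorbed into K^12, and (K^3)^4 gives another K^12.\<close>
    have "4096 * (K ^ 3) ^ 4 \<le> K ^ 12 * (K ^ 3) ^ 4" using pow2[of 12] K by (intro mult_right_mono) auto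
    also have "\<dots> = K ^ 24" by (simp flip: power_add power_mult)
    finally have "4096 * (K ^ 3) ^ 4 * b \<le> K ^ 24 * b" using b by (intro mult_right_mono) auto
    then show ?thesis using B(3) by (simp add: b_def)
  qed
  obtain S where S: "S \<subseteq> B + uminus ` B" "0 \<in> S" "uminus ` S = S" "card B \<le> 2 * card S"
    and Sn: "\<And>n. real (card ((B + uminus ` B) + nsums n S)) \<le> (2 * K ^ 24) ^ n * (K ^ 24) ^ Suc n * card B"
    using popular_differences[OF finB neB, of "K ^ 24"] BB by (auto simp: b_def)
  define s where "s = real (card S)"
  have SF: "S \<subseteq> F"
  proof
    fix z assume "z \<in> S"
    then obtain x y where "x \<in> B" "y \<in> B" "z = x - y"
      using S(1) by (blast elim: in_set_plus_uminusE)
    then show "z \<in> F" using BF by (auto intro: diff_in)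
  qed
  have finS: "finite S" using SF finite_F finite_subset by blast
  have s: "s > 0" using finS S(2) by (auto simp: s_def card_gt_0_iff)
  have bs: "b \<le> 2 * s" using S(4) by (simp add: b_def s_def)
  have finBB: "finite (B + uminus ` B)" using finB by (intro finite_set_plus) auto
  have Sn': "real (card ((B + uminus ` B) + nsums n S)) \<le> K ^ (49 * n + 24) * b" for n
  proof -
    have "(2 * K ^ 24) ^ n * (K ^ 24) ^ Suc n \<le> (K * K ^ 24) ^ n * (K ^ 24) ^ Suc n"
      using K by (intro mult_right_mono power_mono) auto
    also have "\<dots> = K ^ (25 * n + 24 * Suc n)"
    proof -
      have "K * K ^ 24 = K ^ 25" by (simp flip: power_Suc)
      then show ?thesis by (simp only: power_add power_mult)
    qed
    also have "25 * n + 24 * Suc n = 49 * n + 24" by simp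
    finally have "(2 * K ^ 24) ^ n * (K ^ 24) ^ Suc n * b \<le> K ^ (49 * n + 24) * b"
      using b by (intro mult_right_mono) auto
    then show ?thesis using Sn[of n] by (simp add: b_def)
  qed
  have S1: "real (card ((B + uminus ` B) + S)) \<le> K ^ 73 * b"
    using Sn'[of 1] by simp
  have "s \<le> card (B + uminus ` B)"
    unfolding s_def using S(1) finBB by (simp add: card_mono)
  then have sa: "s \<le> K ^ 24 * a"
  proof -
    have "b \<le> a" using card_mono[OF finA B(1)] by (simp add: a_def b_def)
    then have "K ^ 24 * b \<le> K ^ 24 * a" using K by (intro mult_left_mono) auto
    then show ?thesis using BB \<open>s \<le> card (B + uminus ` B)\<close> by linarith
  qed
  have "b \<le> K * s" using bs K s mult_right_mono[of 2 K s] by linarith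
  then have as: "a \<le> K ^ 6 * s"
    using ab mult_left_mono[of b "K * s" "K ^ 5"] K by (simp add: power_Suc2[symmetric] mult.assoc[symmetric] del: power_Suc)
  have neV: "V \<noteq> {}" using V(1) K by (auto simp: not_le)
  have nz: "h \<noteq> 0" if "h \<in> V" for h using that VF by auto
  \<comment> \<open>The dilates of the smaller set \<open>B\<close> still lie in \<open>D\<close>;
    the price is K^5 for the loss from \<open>A\<close> to \<open>B\<close>.\<close>
  have DB: "real (card D) \<le> K ^ 6 * real (card B)"
    using cD mult_left_mono[OF ab, of K] K by (simp add: a_def b_def power_Suc[symmetric] mult.assoc[symmetric] del: power_Suc)
  have subD: "h *o B \<subseteq> D" if "h \<in> V" for h
    using sub[OF that] B(1) by (meson order_trans set_times_mono)
  have dil: "card (h *o B) = card B" if "h \<in> V" for h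
    using card_elt_set_times[of h B] that VF nz BF by auto
  have "card B > 0" "K ^ 6 > 0" using b K by (auto simp: b_def)
  then obtain h0 where h0: "h0 \<in> V"
    "real (card V) \<le> 2 * K ^ 6 * card {h \<in> V. real (card B) \<le> 2 * K ^ 6 * card (h *o B \<inter> h0 *o B)}"
    using exists_common_dilate[where f = "\<lambda>h. h *o B", OF finV D neV _ _ subD dil DB] by blast
  define V1 where "V1 = {h \<in> V. real (card B) \<le> 2 * K ^ 6 * card (h *o B \<inter> h0 *o B)}"
  have h0F: "h0 \<in> F" "h0 \<noteq> 0" using h0 VF nz by auto
  obtain k0 where k0: "k0 \<in> F" "k0 * h0 = e" using ex_inverse[OF h0F] by blast
  have k0nz: "k0 \<noteq> 0" using k0 e_nonzero by auto
  \<comment> \<open>Normalising by \<open>h0\<close> produces the ratios h/h0 to which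
    \<open>covered_ratio\<close> applies.\<close>
  define U where "U = k0 *o V1"
  have V1F: "V1 \<subseteq> F" using VF by (auto simp: V1_def)
  have UF: "U \<subseteq> F" using V1F k0 by (auto simp: U_def elt_set_times_def intro: mult_in)
  have cU: "card U = card V1" unfolding U_def by (rule card_elt_set_times[OF k0(1) k0nz V1F])
  have "card V \<le> K ^ 7 * card V1"
  proof -
    have "2 * K ^ 6 * card V1 \<le> K * K ^ 6 * card V1" using K by (intro mult_right_mono) auto
    then show ?thesis using h0(2) by (simp add: V1_def power_Suc[symmetric] del: power_Suc)
  qed
  then have VU: "card V / K ^ 7 \<le> card U"
    using K by (simp add: cU field_simps)
  moreover have "2 \<le> card V / K ^ 7" using V(1) K by (simp add: field_simps)
  ultimately have U2: "card U \<ge> 2" by linarith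
  have "(card V / K ^ 7) ^ 2 ^ j \<le> real (card U) ^ 2 ^ j"
    using VU K by (intro power_mono) auto
  with V(2) have "real (card F) < real (card U) ^ 2 ^ j" by (rule less_le_trans)
  then have bigU: "card F < card U ^ 2 ^ j" by (simp only: of_nat_less_iff flip: of_nat_power)
  \<comment> \<open>160 = 80 + 80 for the two coverings; 80 = 73 + 7, where 73 = 49 + 24 is the
    sumset bound at n = 1 and 7 comes from the overlap of the dilates.\<close>
  have cov: "covered S (K ^ 160) 2 u" if u: "u \<in> U" for u
  proof -
    obtain h where h: "h \<in> V1" "u = k0 * h" using u by (auto simp: U_def elt_set_times_def)
    have meet: "b \<le> 2 * K ^ 6 * card (h *o B \<inter> h0 *o B)" using h by (simp add: V1_def b_def)
    have "2 * K ^ 6 * real (card (h *o B \<inter> h0 *o B)) \<le> K * K ^ 6 * card (h *o B \<inter> h0 *o B)"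
      using K by (intro mult_right_mono) auto
    with meet have "b \<le> K ^ 7 * card (h *o B \<inter> h0 *o B)"
      by (simp add: power_Suc[symmetric] del: power_Suc)
    then have "K ^ 73 * b \<le> K ^ 80 * card (h *o B \<inter> h0 *o B)"
    proof -
      have "K ^ 80 = K ^ 73 * K ^ 7" by (simp flip: power_add)
      moreover have "K ^ 73 * b \<le> K ^ 73 * (K ^ 7 * card (h *o B \<inter> h0 *o B))"
        using \<open>b \<le> K ^ 7 * card (h *o B \<inter> h0 *o B)\<close> K by (intro mult_left_mono) auto
      ultimately show ?thesis by (simp only: mult.assoc)
    qed
    then have 1: "real (card ((B + uminus ` B) + S)) \<le> K ^ 80 * card (h *o B \<inter> h0 *o B)"
      using S1 by linarith
    have "K ^ 73 * b \<le> K ^ 74 * s"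
      using mult_left_mono[OF \<open>b \<le> K * s\<close>, of "K ^ 73"] K by (simp add: power_Suc2[symmetric] mult.assoc[symmetric] del: power_Suc)
    also have "\<dots> \<le> K ^ 80 * s" using s by (intro mult_right_mono pow_mono) auto
    finally have 2: "real (card ((B + uminus ` B) + S)) \<le> K ^ 80 * card S"
      using S1 by (simp add: s_def)
    have "h *o B \<inter> h0 *o B \<noteq> {}" using meet b by (intro notI) simp
    then have "covered S (K ^ 80 * K ^ 80) 2 (k0 * h)"
      using S(2) h V1F h0F k0 K
      by (intro covered_ratio[OF BF SF S(3) _ _ h0F k0 _ 1 2]) auto
    then show ?thesis by (simp add: h(2) flip: power_add)
  qed
  define c M where "c = level_exponent (4 * j + 1)" and "M = (2 ^ 2 ^ (4 * j + 1) :: nat)"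
  define f where "f = real (card F)"
  have f: "f > 0" using finite_F zero_in by (auto simp: f_def card_gt_0_iff)
  define N where "N = 320 * c + 98 * M + 25"
  have nsums_sub: "nsums (2 * M) S \<subseteq> (B + uminus ` B) + nsums (2 * M) S"
    using neB diff_in_set_plus[of _ B _ B] by (intro set_zero_plus2) (metis all_not_in_conv diff_self)
  have "card (nsums (2 * M) S) \<le> card ((B + uminus ` B) + nsums (2 * M) S)"
    by (rule card_mono[OF finite_set_plus[OF finBB finite_nsums[OF finS]] nsums_sub])
  then have "real (card (nsums (2 * M) S)) \<le> K ^ (49 * (2 * M) + 24) * b"
    using Sn'[of "2 * M"] by linarith
  also have "\<dots> \<le> K ^ (49 * (2 * M) + 24) * (K * s)"
    using \<open>b \<le> K * s\<close> K by (intro mult_left_mono) auto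
  finally have nS: "real (card (nsums (2 * M) S)) \<le> K ^ (98 * M + 25) * s"
    by (simp add: power_add algebra_simps power_Suc2[symmetric] numeral_eq_Suc)
  have "f * s ^ 2 \<le> ((K ^ 160) ^ (2 * c) * real (card (nsums (2 * M) S))) * (s ^ 2 + f)"
    unfolding f_def s_def c_def M_def
    by (rule covered_field_bound[OF SF S(2,3) UF U2 bigU _ cov]) (use K1 in auto)
  also have "\<dots> \<le> ((K ^ 160) ^ (2 * c) * (K ^ (98 * M + 25) * s)) * (s ^ 2 + f)"
    using nS f K by (intro mult_right_mono mult_left_mono) auto
  also have "\<dots> = (K ^ N * (s ^ 2 + f)) * s"
    by (simp add: N_def power_add power_mult[symmetric] ac_simps)
  finally have "(f * s) * s \<le> (K ^ N * (s ^ 2 + f)) * s"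
    by (simp add: power2_eq_square mult.assoc)
  then have fs: "f * s \<le> K ^ N * (s ^ 2 + f)"
    by (rule mult_right_le_imp_le) (rule s)
  have exponent: "sum_product_exponent j = N + 25"
    by (simp add: sum_product_exponent_def N_def c_def M_def)
  have dbl: "K ^ N * (2 * t) \<le> K ^ (N + 1) * t" if "t \<ge> 0" for t
    using mult_left_mono[OF mult_right_mono[OF K that], of "K ^ N"] K by (simp add: mult.assoc mult.left_commute)
  \<comment> \<open>The larger of s^2 and f dominates their sum: in one case \<open>S\<close> has at
    most a power of K elements, in the other it nearly fills \<open>F\<close>.\<close>
  show ?thesis
  proof (cases "s ^ 2 \<le> f")
    case True
    have "K ^ N * (s ^ 2 + f) \<le> K ^ N * (2 * f)" using True K by (intro mult_left_mono) auto
    then have "f * s \<le> K ^ (N + 1) * f" using fs dbl[of f] f by linarith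
    then have "s * f \<le> K ^ (N + 1) * f" by (simp only: mult.commute[of f s])
    then have "s \<le> K ^ (N + 1)" by (rule mult_right_le_imp_le) (rule f)
    then have "K ^ 6 * s \<le> K ^ 6 * K ^ (N + 1)" using K by (intro mult_left_mono) auto
    also have "\<dots> = K ^ (6 + (N + 1))" by (simp only: power_add)
    also have "\<dots> \<le> K ^ (N + 25)" by (rule pow_mono) simp
    finally show ?thesis using as by (simp add: exponent a_def)
  next
    case False
    have "K ^ N * (s ^ 2 + f) \<le> K ^ N * (2 * s ^ 2)" using False K by (intro mult_left_mono) auto
    then have "f * s \<le> (K ^ (N + 1) * s) * s"
      using fs dbl[of "s ^ 2"] by (simp add: power2_eq_square mult.assoc)
    then have "f \<le> K ^ (N + 1) * s" by (rule mult_right_le_imp_le) (rule s)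
    also have "\<dots> \<le> K ^ (N + 1) * (K ^ 24 * a)" using sa K by (intro mult_left_mono) auto
    also have "K ^ (N + 1) * (K ^ 24 * a) = K ^ (N + 25) * a"
    proof -
      have "K ^ (N + 1) * K ^ 24 = K ^ (N + 25)" by (subst power_add[symmetric]) (simp add: add.commute)
      then show ?thesis by (simp only: mult.assoc[symmetric])
    qed
    finally show ?thesis by (simp add: exponent a_def f_def)
  qed
qed

section \<open>All prime fields inside one ring\<close>

text \<open>The product of all rings of integers modulo \<open>n\<close>: as \<open>p\<close> is a variable, its prime field cannot
  be a type, but it sits in this ring as the \<open>p\<close>-th factor.\<close>

definition residue_eq :: "(nat \<Rightarrow> int) \<Rightarrow> (nat \<Rightarrow> int) \<Rightarrow> bool"
  where "residue_eq f g \<longleftrightarrow> (\<forall>n. [f n = g n] (mod int n))"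

quotient_type residue_product = "nat \<Rightarrow> int" / residue_eq
  by (rule equivpI) (auto simp: residue_eq_def reflp_def symp_def transp_def intro: cong_sym cong_trans)

instantiation residue_product :: comm_ring
begin

lift_definition zero_residue_product :: residue_product is "\<lambda>_. 0" .

lift_definition plus_residue_product :: "residue_product \<Rightarrow> residue_product \<Rightarrow> residue_product"
  is "\<lambda>f g n. f n + g n"
  by (auto simp: residue_eq_def intro: cong_add)

lift_definition minus_residue_product :: "residue_product \<Rightarrow> residue_product \<Rightarrow> residue_product"
  is "\<lambda>f g n. f n - g n"
  by (auto simp: residue_eq_def intro: cong_diff)

lift_definition uminus_residue_product :: "residue_product \<Rightarrow> residue_product"
  is "\<lambda>f n. - f n"
  by (auto simp: residue_eq_def cong_minus_minus_iff)

lift_definition times_residue_product :: "residue_product \<Rightarrow> residue_product \<Rightarrow> residue_product"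
  is "\<lambda>f g n. f n * g n"
  by (auto simp: residue_eq_def intro: cong_mult)

instance
  by standard (transfer; simp add: residue_eq_def algebra_simps)+

end

lift_definition residue_elem :: "nat \<Rightarrow> int \<Rightarrow> residue_product"
  is "\<lambda>p x n. if n = p then x else 0" .

lemma residue_elem_eq_iff: "residue_elem p x = residue_elem p y \<longleftrightarrow> [x = y] (mod int p)"
  by transfer (auto simp: residue_eq_def)

lemma residue_elem_add: "residue_elem p x + residue_elem p y = residue_elem p (x + y)"
  by transfer (auto simp: residue_eq_def)

lemma residue_elem_diff: "residue_elem p x - residue_elem p y = residue_elem p (x - y)"
  by transfer (auto simp: residue_eq_def)

lemma residue_elem_mult: "residue_elem p x * residue_elem p y = residue_elem p (x * y)"
  by transfer (auto simp: residue_eq_def)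

lemma residue_elem_uminus: "- residue_elem p x = residue_elem p (- x)"
  by transfer (auto simp: residue_eq_def)

lemma residue_elem_0: "residue_elem p 0 = 0"
  by transfer (auto simp: residue_eq_def)

lemma residue_elem_mod: "residue_elem p (x mod int p) = residue_elem p x"
  by (simp add: residue_elem_eq_iff cong_def)

lemma residue_elem_eq_0_iff: "residue_elem p x = 0 \<longleftrightarrow> int p dvd x"
  using residue_elem_eq_iff[of p x 0] by (simp add: residue_elem_0 cong_0_iff)

lemma inj_on_residue_elem: "inj_on (residue_elem p) {0..<int p}"
  by (auto simp: inj_on_def residue_elem_eq_iff cong_def)

lemma range_residue_elem:
  assumes "p > 0"
  shows "range (residue_elem p) = residue_elem p ` {0..<int p}"
proof -
  have "residue_elem p x \<in> residue_elem p ` {0..<int p}" for x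
    by (rule image_eqI[of _ _ "x mod int p"]) (use assms in \<open>simp_all add: residue_elem_mod\<close>)
  then show ?thesis by blast
qed

lemma card_range_residue_elem: "p > 0 \<Longrightarrow> card (range (residue_elem p)) = p"
  by (simp add: range_residue_elem card_image inj_on_residue_elem)

lemma finite_prime_subfield_residue_elem:
  assumes "prime p"
  shows "finite_prime_subfield (range (residue_elem p)) (residue_elem p 1)"
proof
  have p: "p > 0" using assms by (rule prime_gt_0_nat)
  show "finite (range (residue_elem p))"
    by (simp add: range_residue_elem[OF p])
  show "0 \<in> range (residue_elem p)"
    using residue_elem_0[of p] by (metis rangeI)
  show "residue_elem p 1 \<noteq> 0"
    using assms by (auto simp: residue_elem_eq_0_iff prime_gt_1_nat)
  show "\<exists>y\<in>range (residue_elem p). y * x = residue_elem p 1"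
    if x: "x \<in> range (residue_elem p)" "x \<noteq> 0" for x
  proof -
    obtain a where a: "x = residue_elem p a" using x(1) by (rule rangeE)
    then have "\<not> int p dvd a"
      using x(2) by (simp add: residue_elem_eq_0_iff)
    then have "coprime a (int p)"
      using assms prime_imp_coprime[of "int p" a] by (simp add: coprime_commute)
    then obtain b where "[a * b = 1] (mod int p)"
      using cong_solve_coprime_int by blast
    then have "residue_elem p b * x = residue_elem p 1"
      by (simp add: a residue_elem_mult residue_elem_eq_iff mult.commute)
    then show ?thesis by blast
  qed
  show "range (residue_elem p) \<subseteq> X"
    if X: "0 \<in> X" "\<And>x. x \<in> range (residue_elem p) \<Longrightarrow> x \<in> X \<Longrightarrow> x + residue_elem p 1 \<in> X" for X
  proof -
    have *: "residue_elem p (int n) \<in> X" for n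
    proof (induction n)
      case 0
      then show ?case using X(1) by (simp add: residue_elem_0)
    next
      case (Suc n)
      then show ?case using X(2)[of "residue_elem p (int n)"]
        by (simp add: residue_elem_add add.commute)
    qed
    have "residue_elem p a \<in> X" for a
      using *[of "nat (a mod int p)"] p by (simp add: residue_elem_mod)
    then show ?thesis by blast
  qed
qed (auto simp: residue_elem_add residue_elem_mult residue_elem_uminus)

section \<open>Large spectra of power segments\<close>

definition add_char :: "nat \<Rightarrow> int \<Rightarrow> complex"
  where "add_char p a = cis (2 * pi * real_of_int a / real p)"

lemma add_char_add: "add_char p (a + b) = add_char p a * add_char p b"
  by (simp add: add_char_def cis_mult ring_distribs add_divide_distrib)

lemma norm_add_char [simp]: "norm (add_char p a) = 1"
  by (simp add: add_char_def)

lemma cnj_add_char: "cnj (add_char p a) = add_char p (- a)"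
  by (simp add: add_char_def cis_cnj)

lemma add_char_multiple: "p > 0 \<Longrightarrow> add_char p (int p * k) = 1"
  using cis_multiple_2pi[of "real_of_int k"] by (simp add: add_char_def mult.assoc)

lemma add_char_cong:
  assumes "p > 0" "[a = b] (mod int p)"
  shows "add_char p a = add_char p b"
proof -
  obtain k where "a = b + int p * k"
    using assms(2) by (metis cong_iff_lin cong_sym)
  then show ?thesis by (simp add: add_char_add add_char_multiple[OF assms(1)])
qed

lemma add_char_neq_1:
  assumes "p > 0" "\<not> int p dvd a"
  shows "add_char p a \<noteq> 1"
proof
  assume "add_char p a = 1"
  then have "cos (2 * pi * real_of_int a / real p) = 1"
    by (metis add_char_def cis.simps(1) one_complex.simps(1))
  then obtain k :: int where "2 * pi * real_of_int a / real p = real_of_int k * 2 * pi"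
    using cos_one_2pi_int by auto
  then have "real_of_int a = real_of_int (k * int p)"
    using assms(1) by (simp add: field_simps)
  then have "a = k * int p" by linarith
  then show False using assms(2) by simp
qed

lemma sum_add_char:
  assumes "p > 0"
  shows "(\<Sum>\<xi>\<in>{0..<int p}. add_char p (\<xi> * a)) = (if int p dvd a then of_nat p else 0)"
proof (cases "int p dvd a")
  case True
  then obtain k where "a = int p * k" by blast
  then have "add_char p (\<xi> * a) = 1" for \<xi>
    using add_char_multiple[OF assms, of "\<xi> * k"] by (simp add: mult.left_commute)
  then show ?thesis using True by simp
next
  case False
  let ?s = "\<Sum>\<xi>\<in>{0..<int p}. add_char p (\<xi> * a)"
  \<comment> \<open>Replacing \<xi> by \<xi> + 1 permutes the residues and multiplies the sum by
    \<open>add_char p a\<close>, which is not 1; hence the sum vanishes.\<close>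
  have "add_char p a * ?s = (\<Sum>\<xi>\<in>{0..<int p}. add_char p ((\<xi> + 1) mod int p * a))"
    unfolding sum_distrib_left add_char_add[symmetric]
    by (intro sum.cong refl add_char_cong[OF assms]) (simp add: cong_def ring_distribs mod_simps add.commute)
  also have "\<dots> = ?s"
  proof (rule sum.reindex_bij_betw)
    show "bij_betw (\<lambda>\<xi>. (\<xi> + 1) mod int p) {0..<int p} {0..<int p}"
      by (rule bij_betw_byWitness[where f' = "\<lambda>\<xi>. (\<xi> - 1) mod int p"])
        (use assms in \<open>auto simp: mod_simps\<close>)
  qed
  finally have "(add_char p a - 1) * ?s = 0" by (simp add: algebra_simps)
  then show ?thesis using add_char_neq_1[OF assms False] False by simp
qed

definition char_sum :: "nat \<Rightarrow> int set \<Rightarrow> int \<Rightarrow> complex"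
  where "char_sum p X \<xi> = (\<Sum>x\<in>X. add_char p (x * \<xi>))"

lemma char_sum_cong: "p > 0 \<Longrightarrow> [\<xi> = \<eta>] (mod int p) \<Longrightarrow> char_sum p X \<xi> = char_sum p X \<eta>"
  unfolding char_sum_def by (intro sum.cong refl add_char_cong cong_mult) auto

lemma norm_char_sum_le: "norm (char_sum p X \<xi>) \<le> card X"
  unfolding char_sum_def by (rule order_trans[OF norm_sum]) simp

lemma char_sum_Parseval:
  assumes p: "p > 0" and X: "X \<subseteq> {0..<int p}"
  shows "(\<Sum>\<xi>\<in>{0..<int p}. norm (char_sum p X \<xi>) ^ 2) = real p * card X"
proof -
  have fin: "finite X" using X finite_subset by blast
  have "of_real (\<Sum>\<xi>\<in>{0..<int p}. norm (char_sum p X \<xi>) ^ 2) =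
      (\<Sum>\<xi>\<in>{0..<int p}. \<Sum>x\<in>X. \<Sum>y\<in>X. add_char p (\<xi> * (x - y)))"
    unfolding of_real_sum complex_norm_square char_sum_def cnj_sum cnj_add_char
      sum_product add_char_add[symmetric]
    by (simp add: algebra_simps)
  also have "\<dots> = (\<Sum>x\<in>X. \<Sum>\<xi>\<in>{0..<int p}. \<Sum>y\<in>X. add_char p (\<xi> * (x - y)))"
    by (rule sum.swap)
  also have "\<dots> = (\<Sum>x\<in>X. \<Sum>y\<in>X. \<Sum>\<xi>\<in>{0..<int p}. add_char p (\<xi> * (x - y)))"
    by (rule sum.cong[OF refl], rule sum.swap)
  also have "\<dots> = (\<Sum>x\<in>X. \<Sum>y\<in>X. if y = x then of_nat p else 0)"
  proof (intro sum.cong refl)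
    fix x y assume xy: "x \<in> X" "y \<in> X"
    have "int p dvd x - y \<longleftrightarrow> y = x"
    proof
      assume "int p dvd x - y"
      then have "x mod int p = y mod int p" by (simp add: mod_eq_dvd_iff)
      moreover have "x mod int p = x" "y mod int p = y" using xy X by auto
      ultimately show "y = x" by simp
    qed auto
    then show "(\<Sum>\<xi>\<in>{0..<int p}. add_char p (\<xi> * (x - y))) = (if y = x then of_nat p else 0)"
      by (simp add: sum_add_char[OF p])
  qed
  also have "\<dots> = of_real (real p * card X)"
    using fin by simp
  finally show ?thesis by (simp only: of_real_eq_iff)
qed

text \<open>Weights of norm at most 1 align the phases. After exchanging summations, apply
  Cauchy-Schwarz over \<open>X\<close> and expand the square: the inner sums over \<open>X\<close>
  are character sums at differences of frequencies, and absolute values remove the weights.\<close>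

lemma char_sum_differences:
  fixes \<theta> :: real
  assumes "finite X" "finite L" and "\<theta> \<ge> 0"
    and L: "\<And>\<xi>. \<xi> \<in> L \<Longrightarrow> \<theta> * card X \<le> norm (char_sum p X \<xi>)"
  shows "\<theta> ^ 2 * card L ^ 2 * card X \<le> (\<Sum>\<xi>\<in>L. \<Sum>\<eta>\<in>L. norm (char_sum p X (\<xi> - \<eta>)))"
proof (cases "X = {}")
  case False
  define n where "n = real (card X)"
  have n: "n > 0" using False assms by (simp add: n_def card_gt_0_iff)
  \<comment> \<open>\<open>sgn\<close> is 0 where the character sum vanishes, so the norm is at most
    1 and not always equal to 1.\<close>
  define c where "c \<xi> = cnj (sgn (char_sum p X \<xi>))" for \<xi>
  have normc: "norm (c \<xi>) \<le> 1" for \<xi> by (simp add: c_def norm_sgn)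
  have c: "c \<xi> * char_sum p X \<xi> = of_real (norm (char_sum p X \<xi>))" for \<xi>
    unfolding c_def sgn_eq
    by (simp add: mult.commute complex_norm_square[symmetric] power2_eq_square)
  define f where "f x = (\<Sum>\<xi>\<in>L. c \<xi> * add_char p (x * \<xi>))" for x
  have "\<theta> * card L * n = (\<Sum>\<xi>\<in>L. \<theta> * n)" by simp
  also have "\<dots> \<le> (\<Sum>\<xi>\<in>L. norm (char_sum p X \<xi>))"
    by (rule sum_mono) (use L in \<open>simp add: n_def\<close>)
  also have "\<dots> = norm (\<Sum>\<xi>\<in>L. c \<xi> * char_sum p X \<xi>)"
    by (simp add: c sum_nonneg flip: of_real_sum)
  also have "(\<Sum>\<xi>\<in>L. c \<xi> * char_sum p X \<xi>) = (\<Sum>x\<in>X. f x)"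
    unfolding f_def char_sum_def sum_distrib_left by (rule sum.swap)
  also have "norm \<dots> \<le> (\<Sum>x\<in>X. norm (f x) * 1)"
    using norm_sum by simp
  finally have "(\<theta> * card L * n) ^ 2 \<le> (\<Sum>x\<in>X. norm (f x) * 1) ^ 2"
    using n \<open>\<theta> \<ge> 0\<close> by (intro power_mono) auto
  also have "\<dots> \<le> (\<Sum>x\<in>X. norm (f x) ^ 2) * (\<Sum>x\<in>X. 1 ^ 2)"
    by (rule Cauchy_Schwarz_ineq_sum)
  also have "\<dots> = (\<Sum>x\<in>X. norm (f x) ^ 2) * n" by (simp add: n_def)
  also have "(\<Sum>x\<in>X. norm (f x) ^ 2) \<le> (\<Sum>\<xi>\<in>L. \<Sum>\<eta>\<in>L. norm (char_sum p X (\<xi> - \<eta>)))"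
  proof -
    have nonneg: "0 \<le> (\<Sum>x\<in>X. norm (f x) ^ 2)" by (simp add: sum_nonneg)
    have "of_real (\<Sum>x\<in>X. norm (f x) ^ 2) =
        (\<Sum>x\<in>X. \<Sum>\<xi>\<in>L. \<Sum>\<eta>\<in>L. (c \<xi> * cnj (c \<eta>)) * (add_char p (x * \<xi>) * add_char p (- (x * \<eta>))))"
      unfolding of_real_sum complex_norm_square f_def cnj_sum complex_cnj_mult cnj_add_char
        sum_product by (simp add: ac_simps)
    also have "\<dots> = (\<Sum>x\<in>X. \<Sum>\<xi>\<in>L. \<Sum>\<eta>\<in>L. (c \<xi> * cnj (c \<eta>)) * add_char p (x * (\<xi> - \<eta>)))"
      by (simp add: algebra_simps flip: add_char_add)
    also have "\<dots> = (\<Sum>\<xi>\<in>L. \<Sum>x\<in>X. \<Sum>\<eta>\<in>L. (c \<xi> * cnj (c \<eta>)) * add_char p (x * (\<xi> - \<eta>)))"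
      by (rule sum.swap)
    also have "\<dots> = (\<Sum>\<xi>\<in>L. \<Sum>\<eta>\<in>L. (c \<xi> * cnj (c \<eta>)) * char_sum p X (\<xi> - \<eta>))"
      unfolding char_sum_def sum_distrib_left by (rule sum.cong[OF refl], rule sum.swap)
    finally have "(\<Sum>x\<in>X. norm (f x) ^ 2) = norm (\<Sum>\<xi>\<in>L. \<Sum>\<eta>\<in>L. (c \<xi> * cnj (c \<eta>)) * char_sum p X (\<xi> - \<eta>))"
      using nonneg by (metis (no_types) norm_of_real abs_of_nonneg)
    also have "\<dots> \<le> (\<Sum>\<xi>\<in>L. \<Sum>\<eta>\<in>L. norm ((c \<xi> * cnj (c \<eta>)) * char_sum p X (\<xi> - \<eta>)))"
      by (intro order_trans[OF norm_sum] sum_mono norm_sum)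
    also have "\<dots> \<le> (\<Sum>\<xi>\<in>L. \<Sum>\<eta>\<in>L. norm (char_sum p X (\<xi> - \<eta>)))"
    proof (intro sum_mono)
      fix \<xi> \<eta>
      have "norm (c \<xi>) * norm (c \<eta>) \<le> 1" using mult_mono[OF normc[of \<xi>] normc[of \<eta>]] by simp
      then show "norm ((c \<xi> * cnj (c \<eta>)) * char_sum p X (\<xi> - \<eta>)) \<le> norm (char_sum p X (\<xi> - \<eta>))"
        by (simp add: norm_mult mult_left_le_one_le)
    qed
    finally show ?thesis .
  qed
  finally have "(\<theta> ^ 2 * card L ^ 2 * n) * n \<le> (\<Sum>\<xi>\<in>L. \<Sum>\<eta>\<in>L. norm (char_sum p X (\<xi> - \<eta>))) * n"
    using n by (simp add: power2_eq_square ac_simps)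
  then have "\<theta> ^ 2 * card L ^ 2 * n \<le> (\<Sum>\<xi>\<in>L. \<Sum>\<eta>\<in>L. norm (char_sum p X (\<xi> - \<eta>)))"
    by (rule mult_right_le_imp_le) (rule n)
  then show ?thesis by (simp add: n_def)
qed (simp add: sum_nonneg)

section \<open>The large spectrum: size, differences and near-invariance\<close>

definition large_spectrum :: "nat \<Rightarrow> int set \<Rightarrow> real \<Rightarrow> int set"
  where "large_spectrum p X \<theta> = {\<xi> \<in> {0..<int p}. \<theta> * card X \<le> norm (char_sum p X \<xi>)}"

lemma finite_large_spectrum [simp]: "finite (large_spectrum p X \<theta>)"
  by (rule finite_subset[of _ "{0..<int p}"]) (auto simp: large_spectrum_def)

lemma large_spectrum_mono: "\<theta>' \<le> \<theta> \<Longrightarrow> large_spectrum p X \<theta> \<subseteq> large_spectrum p X \<theta>'"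
  by (auto simp: large_spectrum_def intro: order_trans[OF mult_right_mono])

lemma card_large_spectrum:
  fixes \<theta> :: real
  assumes p: "p > 0" and X: "X \<subseteq> {0..<int p}" "X \<noteq> {}" and \<theta>: "\<theta> \<ge> 0"
  shows "\<theta> ^ 2 * card X * card (large_spectrum p X \<theta>) \<le> p"
proof -
  define n where "n = real (card X)"
  have n: "n > 0" using X finite_subset[OF X(1)] by (simp add: n_def card_gt_0_iff)
  have "(\<theta> ^ 2 * n * card (large_spectrum p X \<theta>)) * n = (\<Sum>\<xi>\<in>large_spectrum p X \<theta>. (\<theta> * n) ^ 2)"
    by (simp add: power2_eq_square)
  also have "\<dots> \<le> (\<Sum>\<xi>\<in>large_spectrum p X \<theta>. norm (char_sum p X \<xi>) ^ 2)"
    using \<theta> n by (intro sum_mono power_mono) (auto simp: large_spectrum_def n_def)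
  also have "\<dots> \<le> (\<Sum>\<xi>\<in>{0..<int p}. norm (char_sum p X \<xi>) ^ 2)"
    by (intro sum_mono2) (auto simp: large_spectrum_def)
  also have "\<dots> = real p * n" by (simp add: char_sum_Parseval[OF p X(1)] n_def)
  finally have "\<theta> ^ 2 * n * card (large_spectrum p X \<theta>) \<le> p"
    by (rule mult_right_le_imp_le) (rule n)
  then show ?thesis by (simp add: n_def)
qed

text \<open>A pair whose difference lies outside the lower spectrum contributes at most \<theta>^3
  \<le> \<theta>^2/2 times card X, so all such pairs make up at most half of the lower bound in
  \<open>char_sum_differences\<close>.\<close>

lemma large_spectrum_differences:
  assumes p: "p > 0" and X: "X \<subseteq> {0..<int p}" "X \<noteq> {}" and \<theta>: "0 \<le> \<theta>" "\<theta> \<le> 1 / 2"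
  defines "L \<equiv> large_spectrum p X \<theta>"
  shows "\<theta> ^ 2 * card L ^ 2 \<le>
    2 * card {(\<xi>, \<eta>). \<xi> \<in> L \<and> \<eta> \<in> L \<and> (\<xi> - \<eta>) mod int p \<in> large_spectrum p X (\<theta> ^ 3)}"
proof -
  define n where "n = real (card X)"
  have finX: "finite X" using X(1) finite_subset by blast
  have n: "n > 0" using X finX by (simp add: n_def card_gt_0_iff)
  have finL: "finite L" by (simp add: L_def)
  define G where "G = {(\<xi>, \<eta>). \<xi> \<in> L \<and> \<eta> \<in> L \<and> (\<xi> - \<eta>) mod int p \<in> large_spectrum p X (\<theta> ^ 3)}"
  have G: "G \<subseteq> L \<times> L" by (auto simp: G_def)
  have "\<theta> ^ 2 * card L ^ 2 * n \<le> (\<Sum>\<xi>\<in>L. \<Sum>\<eta>\<in>L. norm (char_sum p X (\<xi> - \<eta>)))"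
    unfolding n_def using char_sum_differences[OF finX finL \<theta>(1)] by (auto simp: L_def large_spectrum_def)
  also have "\<dots> = (\<Sum>q\<in>L \<times> L. norm (char_sum p X (fst q - snd q)))"
    by (simp add: sum.cartesian_product case_prod_unfold)
  also have "\<dots> = (\<Sum>q\<in>G. norm (char_sum p X (fst q - snd q))) + (\<Sum>q\<in>L \<times> L - G. norm (char_sum p X (fst q - snd q)))"
    using sum.subset_diff[OF G] finL by (simp add: add.commute)
  also have "\<dots> \<le> (\<Sum>q\<in>G. n) + (\<Sum>q\<in>L \<times> L - G. \<theta> ^ 3 * n)"
  proof (intro add_mono sum_mono)
    show "norm (char_sum p X (fst q - snd q)) \<le> n" for q
      unfolding n_def by (rule norm_char_sum_le)
    fix q assume "q \<in> L \<times> L - G"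
    then have "(fst q - snd q) mod int p \<notin> large_spectrum p X (\<theta> ^ 3)"
      by (auto simp: G_def)
    then have "norm (char_sum p X ((fst q - snd q) mod int p)) < \<theta> ^ 3 * n"
      using p by (simp add: large_spectrum_def n_def not_le)
    also have "char_sum p X ((fst q - snd q) mod int p) = char_sum p X (fst q - snd q)"
      by (rule char_sum_cong[OF p]) simp
    finally show "norm (char_sum p X (fst q - snd q)) \<le> \<theta> ^ 3 * n" by simp
  qed
  also have "\<dots> \<le> card G * n + card L ^ 2 * (\<theta> ^ 3 * n)"
  proof -
    have "card (L \<times> L - G) \<le> card (L \<times> L)" using finL by (intro card_mono) auto
    then have "real (card (L \<times> L - G)) \<le> real (card L ^ 2)"
      by (simp only: of_nat_le_iff card_cartesian_product power2_eq_square)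
    then have "real (card (L \<times> L - G)) * (\<theta> ^ 3 * n) \<le> real (card L ^ 2) * (\<theta> ^ 3 * n)"
      using \<theta> n by (intro mult_right_mono) auto
    then show ?thesis by simp
  qed
  also have "\<dots> \<le> card G * n + card L ^ 2 * ((\<theta> ^ 2 / 2) * n)"
  proof -
    have "\<theta> * \<theta> ^ 2 \<le> 1 / 2 * \<theta> ^ 2" using \<theta> by (intro mult_right_mono) auto
    then show ?thesis
      using n by (intro add_mono mult_left_mono mult_right_mono) (auto simp: power2_eq_square power3_eq_cube)
  qed
  finally have "(\<theta> ^ 2 * card L ^ 2) * n \<le> (2 * card G) * n" by (simp add: algebra_simps)
  then have "\<theta> ^ 2 * card L ^ 2 \<le> 2 * card G"
    by (rule mult_right_le_imp_le) (rule n)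
  then show ?thesis by (simp add: G_def)
qed

text \<open>Dilating the frequency by g^s shifts the window of exponents by \<open>s\<close>. The
  loss of 2 s is at most half of \<theta> T by hypothesis, and \<theta>/2 is still at least
  \<theta>^3.\<close>

lemma large_spectrum_shift:
  assumes p: "p > 0" and inj: "inj_on (\<lambda>t. g ^ t mod int p) {..<T}" and \<theta>: "0 \<le> \<theta>" "\<theta> \<le> 1 / 2"
    and s: "4 * real s \<le> \<theta> * T"
    and X: "X = (\<lambda>t. g ^ t mod int p) ` {..<T}" and \<xi>: "\<xi> \<in> large_spectrum p X \<theta>"
  shows "(g ^ s * \<xi>) mod int p \<in> large_spectrum p X (\<theta> ^ 3)"
proof -
  have cX: "card X = T" by (simp add: X card_image[OF inj])
  define u where "u t = add_char p (g ^ t * \<xi>)" for t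
  have S: "char_sum p X \<eta> = (\<Sum>t<T. add_char p (g ^ t * \<eta>))" for \<eta>
    unfolding char_sum_def X sum.reindex[OF inj] o_def
    by (intro sum.cong refl add_char_cong[OF p]) (simp add: cong_def mod_simps)
  have "char_sum p X (g ^ s * \<xi>) = (\<Sum>t<T. u (s + t))"
    by (simp add: S u_def power_add ac_simps)
  \<comment> \<open>The same sum over s + T exponents, cut once after \<open>s\<close> terms and
    once after \<open>T\<close> terms.\<close>
  moreover have "(\<Sum>t<s + T. u t) = (\<Sum>t<s. u t) + (\<Sum>t<T. u (s + t))"
    by (induction T) (simp_all add: add.assoc)
  moreover have "(\<Sum>t<T + s. u t) = (\<Sum>t<T. u t) + (\<Sum>t<s. u (T + t))"
    by (induction s) (simp_all add: add.assoc)
  moreover have "char_sum p X \<xi> = (\<Sum>t<T. u t)" by (simp add: S u_def)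
  ultimately have "char_sum p X \<xi> = char_sum p X (g ^ s * \<xi>) + ((\<Sum>t<s. u t) - (\<Sum>t<s. u (T + t)))"
    by (simp add: add.commute algebra_simps)
  then have "norm (char_sum p X \<xi>) \<le> norm (char_sum p X (g ^ s * \<xi>)) + norm ((\<Sum>t<s. u t) - (\<Sum>t<s. u (T + t)))"
    by (metis norm_triangle_ineq)
  also have "norm ((\<Sum>t<s. u t) - (\<Sum>t<s. u (T + t))) \<le> real s + real s"
    by (intro order_trans[OF norm_triangle_ineq4] add_mono order_trans[OF norm_sum]) (simp_all add: u_def)
  finally have "\<theta> * T - \<theta> * T / 2 \<le> norm (char_sum p X (g ^ s * \<xi>))"
    using \<xi> s by (simp add: large_spectrum_def cX)
  moreover have "\<theta> ^ 3 * T \<le> \<theta> * T / 2"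
  proof -
    have "\<theta> * (\<theta> * \<theta>) \<le> \<theta> * (1 / 2 * 1)" using \<theta> by (intro mult_left_mono mult_mono) auto
    then have "\<theta> ^ 3 * T \<le> (\<theta> * (1 / 2 * 1)) * T" by (intro mult_right_mono) (auto simp: power3_eq_cube mult.assoc)
    then show ?thesis by simp
  qed
  moreover have "char_sum p X ((g ^ s * \<xi>) mod int p) = char_sum p X (g ^ s * \<xi>)"
    by (rule char_sum_cong[OF p]) simp
  ultimately show ?thesis
    using p by (simp add: large_spectrum_def cX)
qed

text \<open>Transports the spectra into \<open>residue_product\<close>. The spectrum at \<theta>^3
  contains the dilates of the one at \<theta> by the first \<open>T'\<close> powers of
  \<open>g\<close>, as well as enough of its differences, and so serves as \<open>D\<close>.\<close>

lemma large_spectrum_dichotomy: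
  fixes \<theta> K :: real and g :: int
  assumes p: "prime p" and g: "\<not> int p dvd g" and inj: "inj_on (\<lambda>t. g ^ t mod int p) {..<T}" and "T > 0"
    and X: "X = (\<lambda>t. g ^ t mod int p) ` {..<T}"
    and \<theta>: "0 < \<theta>" "\<theta> \<le> 1 / 2" and K: "K \<ge> 2" "2 \<le> K * \<theta> ^ 2"
    and ne: "large_spectrum p X \<theta> \<noteq> {}"
    and growth: "card (large_spectrum p X (\<theta> ^ 3)) \<le> K * card (large_spectrum p X \<theta>)"
    and T': "T' \<le> T" "4 * real T' \<le> \<theta> * T" "2 * K ^ 7 \<le> T'" "real p < (T' / K ^ 7) ^ 2 ^ j"
  shows "card (large_spectrum p X \<theta>) \<le> K ^ sum_product_exponent j \<or>
    real p \<le> K ^ sum_product_exponent j * card (large_spectrum p X \<theta>)"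
proof -
  have p0: "p > 0" using p by (rule prime_gt_0_nat)
  define \<pi> where "\<pi> = residue_elem p"
  define L L' where "L = large_spectrum p X \<theta>" and "L' = large_spectrum p X (\<theta> ^ 3)"
  define V where "V = \<pi> ` (\<lambda>t. g ^ t mod int p) ` {..<T'}"
  interpret finite_prime_subfield "range \<pi>" "\<pi> 1"
    unfolding \<pi>_def by (rule finite_prime_subfield_residue_elem[OF p])
  have inj\<pi>: "inj_on \<pi> {0..<int p}" unfolding \<pi>_def by (rule inj_on_residue_elem)
  have sub: "L \<subseteq> {0..<int p}" "L' \<subseteq> {0..<int p}" by (auto simp: L_def L'_def large_spectrum_def)
  have injL: "inj_on \<pi> L" "inj_on \<pi> L'"
    using inj_on_subset[OF inj\<pi>] sub by blast+
  have cL: "card (\<pi> ` L) = card L" "card (\<pi> ` L') = card L'"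
    using injL by (auto intro: card_image)
  have "inj_on (\<lambda>t. g ^ t mod int p) {..<T'}"
    by (rule inj_on_subset[OF inj]) (use T' in auto)
  moreover have "(\<lambda>t. g ^ t mod int p) ` {..<T'} \<subseteq> {0..<int p}" using p0 by auto
  then have "inj_on \<pi> ((\<lambda>t. g ^ t mod int p) ` {..<T'})" by (rule inj_on_subset[OF inj\<pi>])
  ultimately have cV: "card V = T'" by (simp add: V_def card_image)
  have cF: "card (range \<pi>) = p" unfolding \<pi>_def by (rule card_range_residue_elem[OF p0])
  have X_sub: "X \<subseteq> {0..<int p}" "X \<noteq> {}" using X \<open>T > 0\<close> p0 by auto
  have "real (card (\<pi> ` L)) \<le> K ^ sum_product_exponent j \<or>
    real (card (range \<pi>)) \<le> K ^ sum_product_exponent j * card (\<pi> ` L)"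
  proof (rule sum_product_dichotomy[where V = V and D = "\<pi> ` L'"])
    show "0 \<notin> V"
    proof
      assume "0 \<in> V"
      then obtain t where "\<pi> (g ^ t) = 0" by (auto simp: V_def \<pi>_def residue_elem_mod)
      then have "int p dvd g ^ t" by (simp add: \<pi>_def residue_elem_eq_0_iff)
      then show False using g p prime_dvd_power[of "int p" g t] by simp
    qed
    show "h *o (\<pi> ` L) \<subseteq> \<pi> ` L'" if h: "h \<in> V" for h
    proof
      fix x assume x: "x \<in> h *o (\<pi> ` L)"
      obtain t where t: "t < T'" "h = \<pi> (g ^ t)" using h by (auto simp: V_def \<pi>_def residue_elem_mod)
      obtain \<xi> where \<xi>: "\<xi> \<in> L" "x = h * \<pi> \<xi>" using x by (auto simp: elt_set_times_def)
      have "4 * real t \<le> \<theta> * T" using t T' by linarith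
      then have "(g ^ t * \<xi>) mod int p \<in> L'"
        unfolding L'_def using \<xi>(1) \<theta> by (intro large_spectrum_shift[OF p0 inj _ _ _ X]) (auto simp: L_def)
      moreover have "x = \<pi> ((g ^ t * \<xi>) mod int p)"
        by (simp add: \<xi> t \<pi>_def residue_elem_mult residue_elem_mod)
      ultimately show "x \<in> \<pi> ` L'" by blast
    qed
    define G where "G = {(\<xi>, \<eta>). \<xi> \<in> L \<and> \<eta> \<in> L \<and> (\<xi> - \<eta>) mod int p \<in> L'}"
    define G' where "G' = {(x, y). x \<in> \<pi> ` L \<and> y \<in> \<pi> ` L \<and> x - y \<in> \<pi> ` L'}"
    have "card G \<le> card G'"
    proof (rule card_inj_on_le[where f = "map_prod \<pi> \<pi>"])
      show "inj_on (map_prod \<pi> \<pi>) G"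
        by (rule inj_on_subset[OF map_prod_inj_on[OF injL(1) injL(1)]]) (auto simp: G_def)
      show "map_prod \<pi> \<pi> ` G \<subseteq> G'"
      proof
        fix q assume "q \<in> map_prod \<pi> \<pi> ` G"
        then obtain \<xi> \<eta> where q: "q = (\<pi> \<xi>, \<pi> \<eta>)" "\<xi> \<in> L" "\<eta> \<in> L" "(\<xi> - \<eta>) mod int p \<in> L'"
          by (auto simp: G_def)
        moreover have "\<pi> \<xi> - \<pi> \<eta> = \<pi> ((\<xi> - \<eta>) mod int p)"
          by (simp add: \<pi>_def residue_elem_diff residue_elem_mod)
        ultimately show "q \<in> G'" by (auto simp: G'_def)
      qed
      show "finite G'"
        by (rule finite_subset[of _ "\<pi> ` L \<times> \<pi> ` L"]) (auto simp: G'_def L_def)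
    qed
    \<comment> \<open>The density \<theta>^2/2 of good pairs is at least 1/K.\<close>
    have "2 * real (card L) ^ 2 \<le> (K * \<theta> ^ 2) * real (card L) ^ 2"
      using K(2) by (intro mult_right_mono) auto
    also have "\<dots> = K * (\<theta> ^ 2 * real (card L) ^ 2)" by simp
    also have "\<dots> \<le> K * (2 * card G)"
      unfolding G_def L_def L'_def
      using large_spectrum_differences[OF p0 X_sub, of \<theta>] \<theta> K(1) by (intro mult_left_mono) auto
    also have "\<dots> \<le> K * (2 * card G')"
      using \<open>card G \<le> card G'\<close> K(1) by (intro mult_left_mono) auto
    finally show "real (card (\<pi> ` L)) ^ 2 \<le>
        K * card {(x, y). x \<in> \<pi> ` L \<and> y \<in> \<pi> ` L \<and> x - y \<in> \<pi> ` L'}"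
      by (simp add: cL G'_def)
  qed (use K growth T' cV cF cL ne in \<open>auto simp: V_def L_def L'_def\<close>)
  then show ?thesis unfolding cL cF unfolding L_def .
qed

section \<open>Pigeonhole over the levels and the choice of constants\<close>

text \<open>Otherwise the size would grow by more than a factor \<open>q\<close> in each of
  \<open>J\<close> steps and pass \<open>p\<close>. Levels start at 1 because the orbit of the
  initial frequency is placed in the spectrum of level 1.\<close>

lemma exists_slow_growth:
  fixes f :: "nat \<Rightarrow> nat" and q p :: real
  assumes "q > 0" "p < q ^ J" "f 1 > 0" "f (Suc J) \<le> p"
  obtains i where "1 \<le> i" "i \<le> J" "f (Suc i) \<le> q * f i"
proof (rule ccontr)
  assume "\<not> thesis"
  then have step: "q * f i < f (Suc i)" if "1 \<le> i" "i \<le> J" for i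
    using that \<open>\<And>i. 1 \<le> i \<Longrightarrow> i \<le> J \<Longrightarrow> f (Suc i) \<le> q * f i \<Longrightarrow> thesis\<close> by force
  have "q ^ k \<le> f (Suc k)" if "k \<le> J" for k
    using that
  proof (induction k)
    case 0
    then show ?case using \<open>f 1 > 0\<close> by simp
  next
    case (Suc k)
    then have "q * q ^ k \<le> q * f (Suc k)" using \<open>q > 0\<close> by (intro mult_left_mono) auto
    also have "\<dots> < f (Suc (Suc k))" using Suc.prems by (intro step) auto
    finally show ?case by simp
  qed
  then show False using assms(2,4) by force
qed

text \<open>The constants are fixed in the order \<open>j\<close>, \<open>C\<close>, \<epsilon>,
  \<open>J\<close>, \<delta>, all depending on \<alpha> alone. With q = p^\<epsilon> everything is
  measured in powers of q: T exceeds q^(8C), and \<open>\<theta> i\<close> is at least 1/q at every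
  level up to J + 1.\<close>

lemma char_sum_power_segment:
  fixes \<alpha> :: real
  assumes "\<alpha> > 0"
  obtains \<delta> :: real where "\<delta> > 0"
    "\<And>p T g \<xi> X. prime p \<Longrightarrow> T > 0 \<Longrightarrow> \<not> int p dvd g \<Longrightarrow> inj_on (\<lambda>t. g ^ t mod int p) {..<T} \<Longrightarrow>
      X = (\<lambda>t. g ^ t mod int p) ` {..<T} \<Longrightarrow> real T > real p powr \<alpha> \<Longrightarrow> \<xi> \<in> {0<..<int p} \<Longrightarrow>
      norm (char_sum p X \<xi>) \<le> 2 * real p powr (- \<delta>) * T"
proof -
  \<comment> \<open>The ratio T'/K^7 will be at least q^(2C) = p^(\<alpha>/4); with this
    \<open>j\<close> its power of exponent 2^j exceeds p.\<close>
  obtain j where j: "4 / \<alpha> < 2 ^ j" using real_arch_pow[of 2 "4 / \<alpha>"] by auto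
  define C where "C = sum_product_exponent j"
  have C: "C \<ge> 50" by (simp add: C_def sum_product_exponent_def)
  \<comment> \<open>The 8 leaves room: T > q^(8C) has to beat K^C = q^(3C) with several further
    powers of q to spare.\<close>
  define \<epsilon> where "\<epsilon> = \<alpha> / (8 * C)"
  have \<epsilon>: "\<epsilon> > 0" using assms C by (simp add: \<epsilon>_def)
  obtain J :: nat where J: "1 / \<epsilon> < J" using reals_Archimedean2 by blast
  define \<delta> where "\<delta> = \<epsilon> / 3 ^ (J + 1)"
  have \<delta>: "\<delta> > 0" using \<epsilon> by (simp add: \<delta>_def)
  have "norm (char_sum p X \<xi>0) \<le> 2 * real p powr (- \<delta>) * T"
    if p: "prime p" and T: "T > 0" and g: "\<not> int p dvd g" and inj: "inj_on (\<lambda>t. g ^ t mod int p) {..<T}"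
      and X: "X = (\<lambda>t. g ^ t mod int p) ` {..<T}" and T\<alpha>: "real T > real p powr \<alpha>" and \<xi>0: "\<xi>0 \<in> {0<..<int p}"
    for p T :: nat and g \<xi>0 :: int and X
  proof (rule ccontr)
    assume neg: "\<not> ?thesis"
    have p1: "p > 1" using p by (rule prime_gt_1_nat)
    have cX: "card X = T" by (simp add: X card_image[OF inj])
    have X_sub: "X \<subseteq> {0..<int p}" "X \<noteq> {}" using X T p1 by auto
    define \<theta> where "\<theta> i = real p powr (- \<delta> * 3 ^ i)" for i :: nat
    have \<theta>pos: "\<theta> i > 0" for i using p1 by (simp add: \<theta>_def)
    have \<theta>Suc: "\<theta> (Suc i) = \<theta> i ^ 3" for i
      using p1 by (simp add: \<theta>_def powr_realpow[symmetric] powr_powr ac_simps)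
    \<comment> \<open>The trivial bound T and the factor 2 in the claim force \<theta> 0 < 1/2 for
      every p; as q \<theta> 0 \<ge> 1, this also yields q \<ge> 2.\<close>
    have "2 * \<theta> 0 * T < norm (char_sum p X \<xi>0)" using neg by (simp add: \<theta>_def)
    moreover have "norm (char_sum p X \<xi>0) \<le> T" using norm_char_sum_le[of p X \<xi>0] by (simp add: cX)
    moreover have "0 < \<theta> 0 * T" using \<theta>pos[of 0] T by simp
    ultimately have "(2 * \<theta> 0) * T < 1 * T" and \<xi>0L: "\<theta> 0 * T \<le> norm (char_sum p X \<xi>0)"
      by linarith+
    then have "2 * \<theta> 0 < 1" using mult_right_less_imp_less[of "2 * \<theta> 0" "real T" 1] by simp
    then have \<theta>0: "\<theta> 0 \<le> 1 / 2" by simp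
    have \<theta>_mono: "\<theta> k \<le> \<theta> i" if "i \<le> k" for i k
      unfolding \<theta>_def using p1 \<delta> that by (intro powr_mono) (auto intro!: mult_left_mono power_increasing)
    have \<theta>_half: "\<theta> i \<le> 1 / 2" for i using \<theta>_mono[of 0 i] \<theta>0 by simp
    define q where "q = real p powr \<epsilon>"
    have q\<theta>: "1 \<le> q * \<theta> i" if "i \<le> J + 1" for i
    proof -
      have "\<delta> * 3 ^ i \<le> \<delta> * 3 ^ (J + 1)" using \<delta> that by (intro mult_left_mono power_increasing) auto
      also have "\<dots> = \<epsilon>" by (simp add: \<delta>_def)
      finally have "1 \<le> real p powr (\<epsilon> - \<delta> * 3 ^ i)" using p1 by (intro ge_one_powr_ge_zero) auto
      then show ?thesis by (simp add: q_def \<theta>_def flip: powr_add)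
    qed
    have q0: "q > 0" using p1 by (simp add: q_def)
    have q2: "q \<ge> 2"
    proof -
      have "1 \<le> q * (1 / 2)"
        using q\<theta>[of 0] mult_left_mono[OF \<theta>0, of q] q0 by linarith
      then show ?thesis by simp
    qed
    have q_mono: "q ^ m \<le> q ^ n" if "m \<le> n" for m n using q2 that by (intro power_increasing) auto
    have q_pow: "q ^ n = real p powr (\<epsilon> * n)" for n
      using p1 by (simp add: q_def powr_realpow[symmetric] powr_powr)
    have "q ^ (8 * C) = real p powr \<alpha>" unfolding q_pow using C by (simp add: \<epsilon>_def)
    then have Tq: "q ^ (8 * C) < T" using T\<alpha> by simp
    define L where "L i = large_spectrum p X (\<theta> i)" for i
    have finL: "finite (L i)" for i by (simp add: L_def)
    have L_mono: "L i \<subseteq> L k" if "i \<le> k" for i k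
      unfolding L_def by (rule large_spectrum_mono[OF \<theta>_mono[OF that]])
    have \<xi>0_in: "\<xi>0 \<in> L 0" using \<xi>0 \<xi>0L by (simp add: L_def large_spectrum_def cX)
    then have L_ne: "L i \<noteq> {}" for i using L_mono[of 0 i] by auto
    have "card (L i) \<le> card {0..<int p}" for i
      by (rule card_mono) (auto simp: L_def large_spectrum_def)
    then have cL: "real (card (L i)) \<le> p" for i by simp
    have "1 < \<epsilon> * J" using J \<epsilon> by (simp add: field_simps)
    then have "real p powr 1 < q ^ J" unfolding q_pow using p1 by (intro powr_less_mono) auto
    then have pJ: "real p < q ^ J" using p1 by simp
    have L1: "card (L 1) > 0" using L_ne finL by (simp add: card_gt_0_iff)
    obtain i where i: "1 \<le> i" "i \<le> J" "real (card (L (Suc i))) \<le> q * card (L i)"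
      using exists_slow_growth[where f = "\<lambda>i. card (L i)", OF q0 pJ L1 cL] by blast
    \<comment> \<open>q^2 compensates for \<theta>^2, and the third factor, being at least 2, for
      the 2 in the density of good pairs.\<close>
    define K where "K = q ^ 3"
    have K2: "K \<ge> 2" using q_mono[of 1 3] q2 by (simp add: K_def)
    have qi: "1 \<le> q * \<theta> i" using q\<theta> i by simp
    \<comment> \<open>The longest shift that \<open>large_spectrum_shift\<close> allows at level
      \<open>i\<close>, rounded down.\<close>
    define T' where "T' = nat \<lfloor>\<theta> i * T / 4\<rfloor>"
    have T'_le: "4 * real T' \<le> \<theta> i * T" 
      using \<theta>pos[of i] of_int_floor_le[of "\<theta> i * T / 4"] by (simp add: T'_def)
    have T'_ge: "q ^ (8 * C - 4) \<le> T'"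
    proof -
      \<comment> \<open>Of the four factors q, one pays for \<open>\<theta> i\<close> and three,
        since q^3 \<ge> 8, for the division by 4 and the rounding.\<close>
      have "q ^ (8 * C - 4) * q ^ 4 \<le> T" using Tq C by (simp flip: power_add)
      also have "\<dots> \<le> (q * \<theta> i) * T" using qi mult_right_mono[of 1 "q * \<theta> i" "real T"] by simp
      finally have "(q ^ (8 * C - 4) * q ^ 3) * q \<le> (\<theta> i * T) * q" by (simp add: eval_nat_numeral ac_simps)
      then have 1: "q ^ (8 * C - 4) * q ^ 3 \<le> \<theta> i * T" by (rule mult_right_le_imp_le) (rule q0)
      have "q ^ (8 * C - 4) * 8 \<le> q ^ (8 * C - 4) * q ^ 3"
        using power_mono[of 2 q 3] q2 by (intro mult_left_mono) auto
      with 1 have "2 * q ^ (8 * C - 4) \<le> \<theta> i * T / 4" by simp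
      moreover have "1 \<le> q ^ (8 * C - 4)" using q2 by simp
      moreover have "\<theta> i * T / 4 < T' + 1" unfolding T'_def using \<theta>pos[of i] by linarith
      ultimately show ?thesis by linarith
    qed
    have "T' \<le> T"
    proof -
      have "\<theta> i * T \<le> 1 * real T" using \<theta>_half[of i] by (intro mult_right_mono) auto
      then show ?thesis using T'_le by simp
    qed
    have dich: "card (L i) \<le> K ^ C \<or> real p \<le> K ^ C * card (L i)"
      unfolding L_def C_def
    proof (rule large_spectrum_dichotomy[OF p g inj T X \<theta>pos \<theta>_half K2 _ _ _ \<open>T' \<le> T\<close> T'_le])
      have "1 \<le> (q * \<theta> i) ^ 2" using qi by simp
      then have "2 * 1 \<le> q * (q * \<theta> i) ^ 2" using q2 by (intro mult_mono) auto
      then show "2 \<le> K * \<theta> i ^ 2" by (simp add: K_def power_mult_distrib eval_nat_numeral ac_simps)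
      show "large_spectrum p X (\<theta> i) \<noteq> {}" using L_ne by (simp add: L_def)
      have "q * card (L i) \<le> K * card (L i)" using q_mono[of 1 3] by (intro mult_right_mono) (auto simp: K_def)
      then show "real (card (large_spectrum p X (\<theta> i ^ 3))) \<le> K * card (large_spectrum p X (\<theta> i))"
        using i(3) by (simp add: L_def flip: \<theta>Suc)
      have "2 * K ^ 7 \<le> q * q ^ 21" using q2 q0 by (simp add: K_def flip: power_mult)
      also have "\<dots> = q ^ 22" by (simp flip: power_Suc)
      also have "\<dots> \<le> q ^ (8 * C - 4)" using C by (intro q_mono) simp
      finally show "2 * K ^ 7 \<le> T'" using T'_ge by simp
      have "4 < \<alpha> * 2 ^ j" using j assms by (simp add: field_simps)
      then have "real p powr 1 < real p powr (\<epsilon> * (2 * C * 2 ^ j))"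
        using p1 C by (intro powr_less_mono) (auto simp: \<epsilon>_def)
      also have "\<dots> = q ^ (2 * C * 2 ^ j)" by (simp add: q_pow)
      finally have "real p < q ^ (2 * C * 2 ^ j)" using p1 by simp
      also have "\<dots> = (q ^ (2 * C)) ^ 2 ^ j" by (simp only: power_mult)
      also have "\<dots> \<le> (T' / K ^ 7) ^ 2 ^ j"
      proof (rule power_mono)
        have "q ^ (2 * C) * K ^ 7 = q ^ (2 * C + 21)" by (simp add: K_def power_add flip: power_mult)
        also have "\<dots> \<le> q ^ (8 * C - 4)" using C by (intro q_mono) simp
        finally show "q ^ (2 * C) \<le> T' / K ^ 7" using T'_ge K2 by (simp add: field_simps)
      qed (use q0 in simp)
      finally show "real p < (T' / K ^ 7) ^ 2 ^ j" .
    qed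
    \<comment> \<open>The orbit of \<xi>0 under the first \<open>T'\<close> powers of
      \<open>g\<close> stays in the spectrum of level 1, hence in that of level i \<ge> 1, which is
      therefore not small.\<close>
    have "T' \<le> card (L i)"
    proof -
      have "card ((\<lambda>t. (g ^ t * \<xi>0) mod int p) ` {..<T'}) = T'"
      proof (subst card_image)
        show "inj_on (\<lambda>t. (g ^ t * \<xi>0) mod int p) {..<T'}"
        proof (rule inj_onI)
          fix s t assume st: "s \<in> {..<T'}" "t \<in> {..<T'}" "(g ^ s * \<xi>0) mod int p = (g ^ t * \<xi>0) mod int p"
          have "\<not> int p dvd \<xi>0" using \<xi>0 zdvd_not_zless by auto
          then have "coprime \<xi>0 (int p)"
            using p prime_imp_coprime[of "int p" \<xi>0] by (simp add: coprime_commute)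
          then have "[g ^ s = g ^ t] (mod int p)"
            using st(3) by (simp add: cong_def[symmetric] cong_mult_rcancel)
          then show "s = t" using st \<open>T' \<le> T\<close> inj by (auto simp: cong_def inj_on_def)
        qed
      qed simp
      moreover have "(\<lambda>t. (g ^ t * \<xi>0) mod int p) ` {..<T'} \<subseteq> L 1"
      proof
        fix x assume "x \<in> (\<lambda>t. (g ^ t * \<xi>0) mod int p) ` {..<T'}"
        then obtain t where t: "t < T'" "x = (g ^ t * \<xi>0) mod int p" by auto
        have "\<theta> i * T \<le> \<theta> 0 * T" using \<theta>_mono[of 0 i] by (intro mult_right_mono) auto
        then have "4 * real t \<le> \<theta> 0 * T" using t T'_le by linarith
        then have "x \<in> large_spectrum p X (\<theta> 0 ^ 3)"
          unfolding t(2) using \<xi>0_in \<theta>pos[of 0] \<theta>0 p1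
          by (intro large_spectrum_shift[OF _ inj _ _ _ X]) (auto simp: L_def)
        then show "x \<in> L 1" by (simp add: L_def \<theta>Suc[of 0, symmetric])
      qed
      ultimately show ?thesis
        using card_mono[OF finL] L_mono[OF i(1)] by (metis order_trans)
    qed
    then have big: "q ^ (8 * C - 4) \<le> card (L i)" using T'_ge by linarith
    have KC: "K ^ C = q ^ (3 * C)" by (simp add: K_def power_mult)
    have strict: "q ^ m < q ^ n" if "m < n" for m n
      using q2 that by (intro power_strict_increasing) auto
    from dich show False
    proof
      assume "card (L i) \<le> K ^ C"
      moreover have "3 * C < 8 * C - 4" using C by linarith
      then have "q ^ (3 * C) < q ^ (8 * C - 4)" by (rule strict)
      ultimately show False using big unfolding KC by linarith
    next
      \<comment> \<open>Parseval with \<theta> i \<ge> 1/q gives T |L i| \<le> q^2 p, so a spectrum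
        of size at least p/q^(3C) would force T \<le> q^(2 + 3C).\<close>
      assume *: "real p \<le> K ^ C * card (L i)"
      have "(1 / q) ^ 2 \<le> \<theta> i ^ 2"
        using qi q0 by (intro power_mono) (auto simp: field_simps)
      then have "(1 / q) ^ 2 * (T * card (L i)) \<le> \<theta> i ^ 2 * (T * card (L i))"
        by (rule mult_right_mono) simp
      also have "\<dots> \<le> p"
        using card_large_spectrum[OF _ X_sub, of "\<theta> i"] \<theta>pos[of i] p1 by (simp add: L_def cX mult.assoc)
      finally have "T * real (card (L i)) \<le> q ^ 2 * p"
        using q0 by (simp add: field_simps power2_eq_square)
      also have "\<dots> \<le> q ^ 2 * (K ^ C * card (L i))"
        using * by (intro mult_left_mono) auto
      finally have "T * real (card (L i)) \<le> q ^ (2 + 3 * C) * card (L i)"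
        by (simp only: KC power_add mult.assoc)
      then have "T \<le> q ^ (2 + 3 * C)"
        by (rule mult_right_le_imp_le) (use L_ne finL in \<open>simp add: card_gt_0_iff\<close>)
      moreover have "2 + 3 * C < 8 * C" using C by linarith
      then have "q ^ (2 + 3 * C) < q ^ (8 * C)" by (rule strict)
      ultimately show False using Tq by linarith
    qed
  qed
  then show thesis using that \<delta> by blast
qed

theorem theorem5p1:
  shows "\<forall>\<alpha>::real. \<alpha> > 0 \<longrightarrow>
    (\<exists>\<beta>::real. \<exists>C::real. \<beta> > 0 \<and> C > 0 \<and>
      (\<forall>(p::nat) (T::nat) (g::int) (H::int set).
         prime p \<longrightarrow> T > 0 \<longrightarrow>
         g \<in> Units (prime_field p) \<longrightarrow> mult_order p g \<ge> T \<longrightarrow>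
         H = power_segment p g T \<longrightarrow>
         card H = T \<longrightarrow> real T > real p powr \<alpha> \<longrightarrow>
         (\<forall>\<psi>::int \<Rightarrow> complex. nontrivial_additive_character p \<psi> \<longrightarrow>
            norm (\<Sum>x\<in>H. \<psi> x) \<le> C * real p powr (- \<beta>) * real (card H))))"
proof (intro allI impI)
  fix \<alpha> :: real
  assume "\<alpha> > 0"
  then obtain \<delta> where \<delta>: "\<delta> > 0" and bound:
    "\<And>p T g \<xi> X. prime p \<Longrightarrow> T > 0 \<Longrightarrow> \<not> int p dvd g \<Longrightarrow> inj_on (\<lambda>t. g ^ t mod int p) {..<T} \<Longrightarrow>
      X = (\<lambda>t. g ^ t mod int p) ` {..<T} \<Longrightarrow> real T > real p powr \<alpha> \<Longrightarrow> \<xi> \<in> {0<..<int p} \<Longrightarrow>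
      norm (char_sum p X \<xi>) \<le> 2 * real p powr (- \<delta>) * T"
    using char_sum_power_segment by blast
  have "norm (\<Sum>x\<in>H. \<psi> x) \<le> 2 * real p powr (- \<delta>) * real (card H)"
    if p: "prime p" and T: "T > 0" and g: "g \<in> Units (prime_field p)" and H: "H = power_segment p g T"
      and card: "card H = T" and T\<alpha>: "real T > real p powr \<alpha>" and \<psi>: "nontrivial_additive_character p \<psi>"
    for p T g H \<psi>
  proof -
    interpret residues_prime p "prime_field p"
      using p by unfold_locales simp_all
    have units: "x \<in> {0<..<int p}" if "x \<in> Units (prime_field p)" for x
      using that prime_gt_1_nat[OF p] by (simp add: res_prime_units_eq of_nat_diff)
    have g': "0 < g" "g < int p" using units[OF g] by auto
    have "g [^]\<^bsub>prime_field p\<^esub> t = g ^ t mod int p" for t :: nat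
      using pow_cong[of g t] g' by simp
    then have HX: "H = (\<lambda>t. g ^ t mod int p) ` {..<T}"
      by (auto simp: H power_segment_def)
    \<comment> \<open>A map from T exponents onto a set of T elements is injective.\<close>
    have inj: "inj_on (\<lambda>t. g ^ t mod int p) {..<T}"
      by (rule eq_card_imp_inj_on) (use card HX in auto)
    obtain \<xi> where \<xi>: "\<xi> \<in> Units (prime_field p)"
      and \<psi>_eq: "\<And>x. x \<in> carrier (prime_field p) \<Longrightarrow>
        \<psi> x = exp (2 * of_real pi * \<i> * of_int x * of_int \<xi> / of_nat p)"
      using \<psi> by (auto simp: nontrivial_additive_character_def)
    have "\<psi> x = add_char p (x * \<xi>)" if "x \<in> H" for x
    proof -
      have "x \<in> carrier (prime_field p)" using that HX by auto
      then show ?thesis by (simp add: \<psi>_eq add_char_def cis_conv_exp ac_simps)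
    qed
    then have "(\<Sum>x\<in>H. \<psi> x) = char_sum p H \<xi>" by (simp add: char_sum_def)
    moreover have "\<not> int p dvd g" using g' zdvd_not_zless by blast
    ultimately show ?thesis
      using bound[OF p T _ inj HX T\<alpha> units[OF \<xi>]] card by simp
  qed
  then show "\<exists>\<beta>::real. \<exists>C::real. \<beta> > 0 \<and> C > 0 \<and>
      (\<forall>(p::nat) (T::nat) (g::int) (H::int set).
         prime p \<longrightarrow> T > 0 \<longrightarrow>
         g \<in> Units (prime_field p) \<longrightarrow> mult_order p g \<ge> T \<longrightarrow>
         H = power_segment p g T \<longrightarrow>
         card H = T \<longrightarrow> real T > real p powr \<alpha> \<longrightarrow>
         (\<forall>\<psi>::int \<Rightarrow> complex. nontrivial_additive_character p \<psi> \<longrightarrow>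
            norm (\<Sum>x\<in>H. \<psi> x) \<le> C * real p powr (- \<beta>) * real (card H)))"
    using \<delta> by (intro exI[of _ \<delta>] exI[of _ "2::real"]) auto
qed

end
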